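(* Let $n\ge3$, let $\eta\in\mathbb C$ be a constant with $\eta\notin\mathbb Z+\tau\mathbb Z$, and let $\phi,\phi_1,\phi_2$ be three linearly independent solutions of the linear system (L) of the context, belonging to $\Theta_{n,u_1+\dots+u_n-\eta}(\tau)$ as functions of $\zeta$. Let $F,G,H$ be functions of $(\zeta,u_1,\dots,u_n)$ satisfying, with $(K,\chi)=(F,\phi),(G,\phi_1),(H,\phi_2)$ respectively, $$K_\zeta=\frac{\chi(\zeta)}{\theta(\zeta-u_1)\cdots\theta(\zeta-u_n)},\qquad K_{u_i}=-\frac{1}{\prod_{m\ne i}\theta(u_i-u_m)}\cdot\frac{\theta(\zeta-u_i+\eta)}{\theta(\eta)\theta(\zeta-u_i)}\cdot\chi(u_i),\quad i=1,\dots,n.$$ Then the system $$\Psi_y=F(\zeta,u_1,\dots,u_n),\qquad \Psi_t=G(\zeta,u_1,\dots,u_n),\qquad \Psi_x=H(\zeta,u_1,\dots,u_n)$$ defines a pseudopotential for some quasilinear system of $m=n$ linearly independent equations of the form $$\sum_{j=1}^n a_{ij}(\mathbf u)u_{jy}+\sum_{j=1}^n b_{ij}(\mathbf u)u_{jt}+\sum_{j=1}^n c_{ij}(\mathbf u)u_{jx}=0,\qquad i=1,\dots,m;$$ that is, the compatibility conditions of the system for $\Psi$ are equivalent to such a system.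
   Context: Everything is local and analytic, on a domain where $u_1,\dots,u_n$ are pairwise distinct modulo $\mathbb Z+\tau\mathbb Z$ and $\zeta\ne u_i$ modulo $\mathbb Z+\tau\mathbb Z$. Fix $\tau\in\mathbb C$ with $\operatorname{Im}\tau>0$ and put $$\theta(z)=\sum_{m\in\mathbb Z}(-1)^m e^{2\pi i\left(mz+\frac{m(m-1)}{2}\tau\right)},$$ an entire function with $\theta(z+1)=\theta(z)$, $\theta(z+\tau)=-e^{-2\pi i z}\theta(z)$, whose only zero modulo $1$ and $\tau$ is $z=0$. For $n\in\mathbb N$, $c\in\mathbb C$, $\Theta_{n,c}(\tau)$ is the ($n$-dimensional) space of entire functions $f$ with $f(z+1)=f(z)$, $f(z+\tau)=(-1)^ne^{-2\pi i(nz-c)}f(z)$. The linear system (L) for $\phi$ (a function of $\zeta,u_1,\dots,u_n$ lying in $\Theta_{n,u_1+\dots+u_n-\eta}(\tau)$ as a function of $\zeta$) is $$\phi_{u_i}(\zeta)=\phi(u_i)\frac{\prod_{m\ne i}\theta(\zeta-u_m)}{\prod_{m\ne i}\theta(u_i-u_m)}\cdot\frac{\theta(\zeta-u_i+\eta)}{\theta(\eta)}\left(\frac{\theta'(\zeta-u_i)}{\theta(\zeta-u_i)}-\frac{\theta'(\zeta-u_i+\eta)}{\theta(\zeta-u_i+\eta)}\right)-\frac{\theta'(\zeta-u_i)}{\theta(\zeta-u_i)}\phi(\zeta),\quad i=1,\dots,n.$$ It is in involution and has an $n$-dimensional space of solutions (linear independence is over constants), and it is the condition for the equations defining $F$ (resp.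 $G$, $H$) to be in involution. Compatibility conditions. For a system $\Psi_y=F(\zeta,\mathbf u)$, $\Psi_t=G(\zeta,\mathbf u)$, $\Psi_x=H(\zeta,\mathbf u)$, where $\zeta$ is a parameter to be eliminated (expressed through $\Psi_y$ from the first equation) and $\mathbf u=\mathbf u(x,y,t)$, the compatibility condition is $$\sum_{i=1}^n(H_{\zeta}G_{u_i}-G_{\zeta}H_{u_i})u_{iy}+\sum_{i=1}^n(F_{\zeta}H_{u_i}-H_{\zeta}F_{u_i})u_{it}+\sum_{i=1}^n(G_{\zeta}F_{u_i}-F_{\zeta}G_{u_i})u_{ix}=0,$$ required to hold identically in $\zeta$. Such a system is a pseudopotential for a quasilinear system for $\mathbf u$ if its compatibility condition is equivalent to that quasilinear system.
   Formalization: For n>3 it is also assumed that each u_i really occurs in at least one of F, G, H (otherwise there are fewer than n independent equations); the n equations are linearly independent at each point of a dense open subset of the u-domain, while the equivalence holds on all of it. *)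

theory Defs
  imports "HOL-Complex_Analysis.Complex_Analysis"
begin

definition period_lattice :: "complex \<Rightarrow> complex set" where
  "period_lattice \<tau> = {of_int a + of_int b * \<tau> | a b. True}"

definition theta :: "complex \<Rightarrow> complex \<Rightarrow> complex" where
  "theta \<tau> z = (\<Sum>\<^sub>\<infinity>m\<in>(UNIV::int set).
     (-1) powi m * exp (2 * of_real pi * \<i> * (of_int m * z + of_int m * (of_int m - 1) / 2 * \<tau>)))"

definition Theta_space :: "nat \<Rightarrow> complex \<Rightarrow> complex \<Rightarrow> (complex \<Rightarrow> complex) set" where
  "Theta_space n c \<tau> = {f. f holomorphic_on UNIV \<and> (\<forall>z. f (z + 1) = f z \<and>
     f (z + \<tau>) = (-1) ^ n * exp (- 2 * of_real pi * \<i> * (of_nat n * z - c)) * f z)}"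

definition upd :: "complex^'k \<Rightarrow> 'k \<Rightarrow> complex \<Rightarrow> complex^'k" where
  "upd u i z = (\<chi> j. if j = i then z else u $ j)"

definition pd :: "(complex^'k \<Rightarrow> complex) \<Rightarrow> 'k \<Rightarrow> complex^'k \<Rightarrow> complex" where
  "pd f i u = deriv (\<lambda>z. f (upd u i z)) (u $ i)"

text \<open>
  Analyticity in several variables, for \<^emph>\<open>open\<close> sets only: continuous and
  holomorphic in each variable separately (by Osgood's lemma, this is analyticity).
\<close>

definition analytic_vec :: "(complex^'k \<Rightarrow> complex) \<Rightarrow> (complex^'k) set \<Rightarrow> bool" where
  "analytic_vec f S \<longleftrightarrow> continuous_on S f \<and>
     (\<forall>u\<in>S. \<forall>i. (\<lambda>z. f (upd u i z)) field_differentiable at (u $ i))"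

definition analytic_pair :: "(complex \<Rightarrow> complex^'k \<Rightarrow> complex) \<Rightarrow> (complex \<times> (complex^'k)) set \<Rightarrow> bool" where
  "analytic_pair f S \<longleftrightarrow> continuous_on S (\<lambda>(\<zeta>, u). f \<zeta> u) \<and>
     (\<forall>(\<zeta>, u)\<in>S. (\<lambda>z. f z u) field_differentiable at \<zeta> \<and>
        (\<forall>i. (\<lambda>z. f \<zeta> (upd u i z)) field_differentiable at (u $ i)))"

definition admissible :: "complex \<Rightarrow> (complex \<times> (complex^'n)) set" where
  "admissible \<tau> = {(\<zeta>, u). (\<forall>i j. i \<noteq> j \<longrightarrow> u $ i - u $ j \<notin> period_lattice \<tau>) \<and>
     (\<forall>i. \<zeta> - u $ i \<notin> period_lattice \<tau>)}"

text \<open>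
  The two lattice conditions on \<open>\<zeta>\<close> only exclude the points where a denominator of the
  right-hand side vanishes (and where division by zero would give a wrong meaning).
\<close>

definition solves_L :: "complex \<Rightarrow> complex \<Rightarrow> (complex^'n) set \<Rightarrow> (complex \<Rightarrow> complex^'n \<Rightarrow> complex) \<Rightarrow> bool" where
  "solves_L \<tau> \<eta> U \<phi> \<longleftrightarrow> (\<forall>u\<in>U. \<forall>\<zeta> i.
     \<zeta> - u $ i \<notin> period_lattice \<tau> \<longrightarrow> \<zeta> - u $ i + \<eta> \<notin> period_lattice \<tau> \<longrightarrow>
     pd (\<phi> \<zeta>) i u =
       \<phi> (u $ i) u
         * ((\<Prod>m\<in>-{i}. theta \<tau> (\<zeta> - u $ m)) / (\<Prod>m\<in>-{i}. theta \<tau> (u $ i - u $ m)))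
         * (theta \<tau> (\<zeta> - u $ i + \<eta>) / theta \<tau> \<eta>)
         * (deriv (theta \<tau>) (\<zeta> - u $ i) / theta \<tau> (\<zeta> - u $ i)
            - deriv (theta \<tau>) (\<zeta> - u $ i + \<eta>) / theta \<tau> (\<zeta> - u $ i + \<eta>))
       - deriv (theta \<tau>) (\<zeta> - u $ i) / theta \<tau> (\<zeta> - u $ i) * \<phi> \<zeta> u)"

definition theta_solution :: "complex \<Rightarrow> complex \<Rightarrow> (complex^'n) set \<Rightarrow> (complex \<Rightarrow> complex^'n \<Rightarrow> complex) \<Rightarrow> bool" where
  "theta_solution \<tau> \<eta> U \<phi> \<longleftrightarrow> analytic_pair \<phi> (UNIV \<times> U) \<and>
     (\<forall>u\<in>U. (\<lambda>\<zeta>. \<phi> \<zeta> u) \<in> Theta_space CARD('n) ((\<Sum>i\<in>UNIV. u $ i) - \<eta>) \<tau>) \<and>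
     solves_L \<tau> \<eta> U \<phi>"

definition lin_indep3 :: "(complex^'n) set \<Rightarrow> (complex \<Rightarrow> complex^'n \<Rightarrow> complex) \<Rightarrow>
    (complex \<Rightarrow> complex^'n \<Rightarrow> complex) \<Rightarrow> (complex \<Rightarrow> complex^'n \<Rightarrow> complex) \<Rightarrow> bool" where
  "lin_indep3 U \<phi> \<phi>1 \<phi>2 \<longleftrightarrow> (\<forall>k k1 k2 :: complex.
     (\<forall>\<zeta>. \<forall>u\<in>U. k * \<phi> \<zeta> u + k1 * \<phi>1 \<zeta> u + k2 * \<phi>2 \<zeta> u = 0) \<longrightarrow> k = 0 \<and> k1 = 0 \<and> k2 = 0)"

definition potential_eqs :: "complex \<Rightarrow> complex \<Rightarrow> (complex \<times> (complex^'n)) set \<Rightarrow>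
    (complex \<Rightarrow> complex^'n \<Rightarrow> complex) \<Rightarrow> (complex \<Rightarrow> complex^'n \<Rightarrow> complex) \<Rightarrow> bool" where
  "potential_eqs \<tau> \<eta> D K \<phi> \<longleftrightarrow> analytic_pair K D \<and> (\<forall>(\<zeta>, u)\<in>D.
     deriv (\<lambda>z. K z u) \<zeta> = \<phi> \<zeta> u / (\<Prod>m\<in>UNIV. theta \<tau> (\<zeta> - u $ m)) \<and>
     (\<forall>i. pd (K \<zeta>) i u =
        - (1 / (\<Prod>m\<in>-{i}. theta \<tau> (u $ i - u $ m)))
        * (theta \<tau> (\<zeta> - u $ i + \<eta>) / (theta \<tau> \<eta> * theta \<tau> (\<zeta> - u $ i))) * \<phi> (u $ i) u))"

text \<open>
  The independent variables \<open>(x, y, t)\<close> form a vector \<open>p\<close> with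
  \<open>x = p $ 1\<close>, \<open>y = p $ 2\<close>, \<open>t = p $ 3\<close>, and \<open>w\<close> is the unknown vector function
  \<open>\<^bold>u(x, y, t)\<close>.
\<close>

definition dvec :: "(complex^3 \<Rightarrow> complex^'n) \<Rightarrow> 3 \<Rightarrow> complex^3 \<Rightarrow> complex^'n" where
  "dvec w k p = (\<chi> i. pd (\<lambda>q. w q $ i) k p)"

definition compatible_at :: "(complex \<times> (complex^'n)) set \<Rightarrow> (complex \<Rightarrow> complex^'n \<Rightarrow> complex) \<Rightarrow>
    (complex \<Rightarrow> complex^'n \<Rightarrow> complex) \<Rightarrow> (complex \<Rightarrow> complex^'n \<Rightarrow> complex) \<Rightarrow>
    (complex^3 \<Rightarrow> complex^'n) \<Rightarrow> complex^3 \<Rightarrow> bool" where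
  "compatible_at D F G H w p \<longleftrightarrow> (\<forall>\<zeta>. (\<zeta>, w p) \<in> D \<longrightarrow>
     (let F\<zeta> = deriv (\<lambda>z. F z (w p)) \<zeta>; Fu = (\<lambda>i. pd (F \<zeta>) i (w p));
          G\<zeta> = deriv (\<lambda>z. G z (w p)) \<zeta>; Gu = (\<lambda>i. pd (G \<zeta>) i (w p));
          H\<zeta> = deriv (\<lambda>z. H z (w p)) \<zeta>; Hu = (\<lambda>i. pd (H \<zeta>) i (w p));
          wx = dvec w 1 p; wy = dvec w 2 p; wt = dvec w 3 p
      in (\<Sum>i\<in>UNIV. (H\<zeta> * Gu i - G\<zeta> * Hu i) * wy $ i)
         + (\<Sum>i\<in>UNIV. (F\<zeta> * Hu i - H\<zeta> * Fu i) * wt $ i)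
         + (\<Sum>i\<in>UNIV. (G\<zeta> * Fu i - F\<zeta> * Gu i) * wx $ i) = 0))"

definition quasilinear_at :: "(complex^'n \<Rightarrow> complex^'n^'m) \<Rightarrow> (complex^'n \<Rightarrow> complex^'n^'m) \<Rightarrow>
    (complex^'n \<Rightarrow> complex^'n^'m) \<Rightarrow> (complex^3 \<Rightarrow> complex^'n) \<Rightarrow> complex^3 \<Rightarrow> bool" where
  "quasilinear_at a b c w p \<longleftrightarrow> (\<forall>i.
     (\<Sum>j\<in>UNIV. a (w p) $ i $ j * dvec w 2 p $ j)
     + (\<Sum>j\<in>UNIV. b (w p) $ i $ j * dvec w 3 p $ j)
     + (\<Sum>j\<in>UNIV. c (w p) $ i $ j * dvec w 1 p $ j) = 0)"

text \<open>
  Linear independence of the equations: at every point of \<open>V\<close> the rows of the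
  block matrix \<open>(a | b | c)\<close> are linearly independent.
\<close>

definition independent_equations :: "(complex^'n) set \<Rightarrow> (complex^'n \<Rightarrow> complex^'n^'m) \<Rightarrow>
    (complex^'n \<Rightarrow> complex^'n^'m) \<Rightarrow> (complex^'n \<Rightarrow> complex^'n^'m) \<Rightarrow> bool" where
  "independent_equations V a b c \<longleftrightarrow> (\<forall>u\<in>V. \<forall>l :: complex^'m.
     l v* a u = 0 \<and> l v* b u = 0 \<and> l v* c u = 0 \<longrightarrow> l = 0)"

text \<open>
  \<open>D\<close> is the domain of \<open>F, G, H\<close>, and the unknown functions take values in its projection
  \<open>snd ` D\<close>, so that the compatibility condition is never void. The equivalence is stated at
  each point \<open>p\<close>, hence the two systems also have the same solutions on each open set.
\<close>

definition pseudopotential_for :: "(complex \<times> (complex^'n)) set \<Rightarrow>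
    (complex \<Rightarrow> complex^'n \<Rightarrow> complex) \<Rightarrow> (complex \<Rightarrow> complex^'n \<Rightarrow> complex) \<Rightarrow>
    (complex \<Rightarrow> complex^'n \<Rightarrow> complex) \<Rightarrow> (complex^'n \<Rightarrow> complex^'n^'m) \<Rightarrow>
    (complex^'n \<Rightarrow> complex^'n^'m) \<Rightarrow> (complex^'n \<Rightarrow> complex^'n^'m) \<Rightarrow> bool" where
  "pseudopotential_for D F G H a b c \<longleftrightarrow>
     (\<forall>W w. open W \<longrightarrow> (\<forall>i. analytic_vec (\<lambda>p. w p $ i) W) \<longrightarrow> w ` W \<subseteq> snd ` D \<longrightarrow>
        (\<forall>p\<in>W. compatible_at D F G H w p \<longleftrightarrow> quasilinear_at a b c w p))"

text \<open>
  \<open>F, G, H\<close> really are functions of all of \<open>u\<^sub>1, \<dots>, u\<^sub>n\<close>. For \<open>n > 3\<close> this does not follow from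
  the linear independence of \<open>\<phi>, \<phi>\<^sub>1, \<phi>\<^sub>2\<close>: with \<open>f' = \<theta>(z + \<eta>) / (\<theta>(\<eta>) \<theta>(z))\<close>, the functions
  \<open>f(\<zeta> - u\<^sub>1), f(\<zeta> - u\<^sub>2), f(\<zeta> - u\<^sub>3)\<close> satisfy all the equations, but their compatibility
  condition consists of only three independent equations and contains no other \<open>u\<^sub>i\<close>.
\<close>

definition all_variables_occur :: "(complex \<times> (complex^'n)) set \<Rightarrow> (complex \<Rightarrow> complex^'n \<Rightarrow> complex) \<Rightarrow>
    (complex \<Rightarrow> complex^'n \<Rightarrow> complex) \<Rightarrow> (complex \<Rightarrow> complex^'n \<Rightarrow> complex) \<Rightarrow> bool" where
  "all_variables_occur D F G H \<longleftrightarrow> (\<forall>i. \<exists>(\<zeta>, u)\<in>D.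
     pd (F \<zeta>) i u \<noteq> 0 \<or> pd (G \<zeta>) i u \<noteq> 0 \<or> pd (H \<zeta>) i u \<noteq> 0)"

end

(*
  A solution phi of (L) expands in the Lagrange basis of its theta space as
  phi = sum_j p_j e_j, and (L) says exactly that the p_j are constants. Hence
  K_zeta = sum_j p_j rho(zeta - u_j) and K_(u_i) = - p_i rho(zeta - u_i) with
  rho(z) = theta(z + eta) / (theta(eta) theta(z)), and with vectors p_j in C^3 for (F, G, H)
  the compatibility condition is the vanishing of
    sum_(i,j) det(X_i, p_i, p_j) rho(zeta - u_i) rho(zeta - u_j),   X_i = (u_iy, u_it, u_ix).
  Multiplied by theta(eta)^2 prod_m theta(zeta - u_m) this is an element of the n-dimensional space
  Theta_(n, sum u - 2 eta), so it vanishes iff it vanishes at the n points u_k - eta/n; the shift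
  keeps these points independent also when 2 eta is a period. Holomorphic dependence on u reduces
  the independence of the n equations to finding one u for which the sums above span the theta space.
  For n = 3 the products rho rho do. For larger n let one point u_N collide with another one, u_a:
  the configuration degenerates to n - 1 points with p_a replaced by p_a + t p_N, and an element of
  the span that does not vanish at u_a supplies the missing dimension.
*)
theory Submission
  imports Defs
begin

\<comment> \<open>otherwise each \<open>$\<close> is ambiguous and parsing time is exponential in their number\<close>
no_notation fps_nth (infixl \<open>$\<close> 75)

section \<open>Entire functions and the period lattice\<close>

text \<open>The zeros of \<open>theta\<close> cannot be read off its series, yet every argument
  divides by \<open>theta\<close>; this is why it is first identified, up to a constant, with an
  infinite product. All comparisons of theta functions then rest on one criterion,
  \<open>Theta_space_unique\<close>: an element of order n and character c that vanishes at n
  incongruent points is zero, provided the sum of the points minus c is not a period. For the nodes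
  u_k - eta/n this difference is eta; for the u_k themselves it would be 2 eta. For n > 3 only two
  facts about the vectors p_i are available: they have rank 3 and none of them is zero. Many
  degenerate positions remain, so the spanning property is built up one point at a time, and the
  weight t must be chosen such that merging keeps the rank. A collided configuration is not
  admissible and may be far from the domain. This does no harm: along the complex line from any
  given u to it, the relevant determinants are entire and not identically zero, so good
  configurations exist arbitrarily close to u. For the same reason independence is obtained on a
  dense open set, whereas the equivalence of the two systems holds at every point.\<close>

lemma division_by_simple_zeros:
  fixes f h :: "complex \<Rightarrow> complex"
  assumes f: "f holomorphic_on UNIV" and h: "h holomorphic_on UNIV"
    and simple: "\<And>z. h z = 0 \<Longrightarrow> deriv h z \<noteq> 0"
    and zero: "\<And>z. h z = 0 \<Longrightarrow> f z = 0"
  obtains g where "g holomorphic_on UNIV" "\<And>z. f z = g z * h z"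
proof
  \<comment> \<open>At a zero of \<open>h\<close> the value is the limit of \<open>f / h\<close>,
    computed as a quotient of difference quotients; with it the singularity is removable.\<close>
  define g where "g = (\<lambda>z. if h z = 0 then deriv f z / deriv h z else f z / h z)"
  have fd: "(f has_field_derivative deriv f z) (at z)" for z
    using f by (auto intro: holomorphic_derivI)
  have hd: "(h has_field_derivative deriv h z) (at z)" for z
    using h by (auto intro: holomorphic_derivI)
  have "g field_differentiable (at z)" for z
  proof (cases "h z = 0")
    case False
    have "open {w. h w \<noteq> 0}"
      using h by (intro open_Collect_neq continuous_intros) (auto intro: holomorphic_on_imp_continuous_on)
    then have "eventually (\<lambda>w. h w \<noteq> 0) (nhds z)"
      using False eventually_nhds_in_open[of "{w. h w \<noteq> 0}" z] by simp
    then have ev: "eventually (\<lambda>w. f w / h w = g w) (nhds z)"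
      by eventually_elim (auto simp: g_def)
    have "(\<lambda>w. f w / h w) field_differentiable (at z)"
      using fd hd False by (intro field_differentiable_divide) (auto simp: field_differentiable_def)
    then show ?thesis
      unfolding field_differentiable_def using DERIV_cong_ev[OF refl ev refl] by blast
  next
    case True
    have lim: "(\<lambda>w. f w / h w) \<midarrow>z\<rightarrow> deriv f z / deriv h z"
    proof -
      have "((\<lambda>w. ((f w - f z) / (w - z)) / ((h w - h z) / (w - z))) \<longlongrightarrow> deriv f z / deriv h z) (at z)"
        using fd hd simple[OF True] by (intro tendsto_divide) (auto simp: has_field_derivative_iff)
      then show ?thesis
        by (rule Lim_transform_eventually)
           (auto simp: eventually_at_filter True zero[OF True])
    qed
    obtain r where r: "r > 0" "\<And>w. w \<in> ball z r - {z} \<Longrightarrow> h w \<noteq> 0"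
    proof -
      have "((\<lambda>w. (h w - h z) / (w - z)) \<longlongrightarrow> deriv h z) (at z)"
        using hd by (auto simp: has_field_derivative_iff)
      then have "eventually (\<lambda>w. (h w - h z) / (w - z) \<noteq> 0) (at z)"
        using simple[OF True] tendsto_imp_eventually_ne by blast
      then have "eventually (\<lambda>w. h w \<noteq> 0) (at z)"
        by eventually_elim (auto simp: True)
      then show ?thesis
        unfolding eventually_at by (auto simp: dist_commute intro: that)
    qed
    have "(\<lambda>w. if w = z then deriv f z / deriv h z else f w / h w) holomorphic_on ball z r"
    proof (rule removable_singularity)
      show "(\<lambda>w. f w / h w) holomorphic_on ball z r - {z}"
        using r by (intro holomorphic_intros holomorphic_on_subset[OF f] holomorphic_on_subset[OF h]) auto
    qed (use lim in auto)
    then have "g holomorphic_on ball z r"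
      by (rule holomorphic_transform) (use r True in \<open>auto simp: g_def\<close>)
    then show ?thesis
      using r(1) holomorphic_on_imp_differentiable_at by (metis centre_in_ball open_ball)
  qed
  then show "g holomorphic_on UNIV"
    by (simp add: holomorphic_on_def)
  show "f z = g z * h z" for z
    by (auto simp: g_def zero)
qed

text \<open>Simple zeros are isolated, so their complement is dense. This extends the multipliers of
  a quotient of theta functions, computed where the denominator is nonzero, to the whole
  plane.\<close>

lemma eq_off_simple_zeros:
  fixes f g h :: "complex \<Rightarrow> complex"
  assumes h: "h holomorphic_on UNIV" and simple: "\<And>z. h z = 0 \<Longrightarrow> deriv h z \<noteq> 0"
    and f: "continuous_on UNIV f" and g: "continuous_on UNIV g"
    and eq: "\<And>z. h z \<noteq> 0 \<Longrightarrow> f z = g z"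
  shows "f z = g z"
proof -
  have "z \<in> closure {z. h z \<noteq> 0}"
  proof (cases "h z = 0")
    case True
    have "(h has_field_derivative deriv h z) (at z)"
      using h by (auto intro: holomorphic_derivI)
    then have "((\<lambda>w. (h w - h z) / (w - z)) \<longlongrightarrow> deriv h z) (at z)"
      by (auto simp: has_field_derivative_iff)
    then have "eventually (\<lambda>w. (h w - h z) / (w - z) \<noteq> 0) (at z)"
      using simple[OF True] by (rule tendsto_imp_eventually_ne)
    then have "eventually (\<lambda>w. h w \<noteq> 0) (at z)"
      by eventually_elim (auto simp: True)
    then obtain d where d: "d > 0" "\<And>x. x \<noteq> z \<Longrightarrow> dist x z < d \<Longrightarrow> h x \<noteq> 0"
      by (auto simp: eventually_at)
    show ?thesis
      unfolding closure_approachable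
    proof (intro allI impI)
      fix e :: real
      assume "e > 0"
      then obtain x where "x \<noteq> z" "dist x z < min d e"
        using perfect_choose_dist[of "min d e" z] d(1) by auto
      then show "\<exists>y\<in>{z. h z \<noteq> 0}. dist y z < e"
        using d(2) by auto
    qed
  qed (auto intro: closure_subset[THEN subsetD])
  moreover have "closure {z. h z \<noteq> 0} \<subseteq> {z. f z = g z}"
    using eq by (intro closure_minimal closed_Collect_eq f g) auto
  ultimately show ?thesis
    by blast
qed

section \<open>The period lattice and quasi-periodic functions\<close>

lemma period_latticeI: "x = of_int a + of_int b * \<tau> \<Longrightarrow> x \<in> period_lattice \<tau>"
  unfolding period_lattice_def by blast

lemma period_latticeE:
  assumes "x \<in> period_lattice \<tau>"
  obtains a b where "x = of_int a + of_int b * \<tau>"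
  using assms unfolding period_lattice_def by blast

lemma period_lattice_0 [simp]: "0 \<in> period_lattice \<tau>"
  by (rule period_latticeI[of _ 0 0]) simp

lemma period_lattice_add: "x \<in> period_lattice \<tau> \<Longrightarrow> y \<in> period_lattice \<tau> \<Longrightarrow> x + y \<in> period_lattice \<tau>"
proof (elim period_latticeE)
  fix a b a' b'
  assume "x = of_int a + of_int b * \<tau>" "y = of_int a' + of_int b' * \<tau>"
  then show ?thesis
    by (intro period_latticeI[of _ "a + a'" "b + b'"]) (simp add: algebra_simps)
qed

lemma period_lattice_minus: "x \<in> period_lattice \<tau> \<Longrightarrow> - x \<in> period_lattice \<tau>"
proof (elim period_latticeE)
  fix a b
  assume "x = of_int a + of_int b * \<tau>"
  then show ?thesis
    by (intro period_latticeI[of _ "- a" "- b"]) simp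
qed

lemma period_lattice_minus_iff [simp]: "- x \<in> period_lattice \<tau> \<longleftrightarrow> x \<in> period_lattice \<tau>"
  using period_lattice_minus[of "- x"] period_lattice_minus[of x] by auto

lemma exp_two_pi_of_int: "exp (2 * of_real pi * \<i> * of_int m) = 1"
  using exp_eq_1 [of "2 * of_real pi * \<i> * of_int m"] by auto

lemma exp_two_pi_eq_1:
  assumes "exp (2 * of_real pi * \<i> * x) = 1"
  obtains k :: int where "x = of_int k"
proof -
  obtain k where "2 * of_real pi * \<i> * x = of_int (2 * k) * pi * \<i>"
    using assms exp_eq_1 [of "2 * of_real pi * \<i> * x"] by (auto simp: complex_eq_iff)
  then have "(2 * of_real pi * \<i>) * x = (2 * of_real pi * \<i>) * of_int k"
    by (simp add: mult_ac)
  then have "x = of_int k"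
    by (subst (asm) mult_cancel_left) simp
  then show ?thesis
    by (rule that)
qed

text \<open>Only the shape of the multiplier is recorded: such periods form a group, so 1 and tau
  generate the whole lattice, and a multiplier without zeros carries zeros and their simplicity
  along it.\<close>

definition exp_quasi_periods :: "(complex \<Rightarrow> complex) \<Rightarrow> complex set" where
  "exp_quasi_periods f = {l. \<exists>a b. \<forall>z. f (z + l) = exp (a + b * z) * f z}"

lemma exp_quasi_periods_add:
  assumes "l \<in> exp_quasi_periods f" "l' \<in> exp_quasi_periods f"
  shows "l + l' \<in> exp_quasi_periods f"
proof -
  obtain a b a' b' where *: "\<And>z. f (z + l) = exp (a + b * z) * f z" "\<And>z. f (z + l') = exp (a' + b' * z) * f z"
    using assms unfolding exp_quasi_periods_def by blast
  have "f (z + (l + l')) = exp ((a + a' + b' * l) + (b + b') * z) * f z" for z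
  proof -
    have "f (z + (l + l')) = exp (a' + b' * (z + l)) * (exp (a + b * z) * f z)"
      using *(2)[of "z + l"] *(1)[of z] by (simp add: add_ac)
    also have "\<dots> = exp ((a' + b' * (z + l)) + (a + b * z)) * f z"
      by (simp add: exp_add mult_ac)
    also have "(a' + b' * (z + l)) + (a + b * z) = (a + a' + b' * l) + (b + b') * z"
      by (simp add: algebra_simps)
    finally show ?thesis .
  qed
  then show ?thesis
    unfolding exp_quasi_periods_def by blast
qed

lemma exp_quasi_periods_minus:
  assumes "l \<in> exp_quasi_periods f"
  shows "- l \<in> exp_quasi_periods f"
proof -
  obtain a b where *: "\<And>z. f (z + l) = exp (a + b * z) * f z"
    using assms unfolding exp_quasi_periods_def by blast
  have "f (z + (- l)) = exp ((- a + b * l) + (- b) * z) * f z" for z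
  proof -
    have "f z = exp (a + b * (z - l)) * f (z - l)"
      using *[of "z - l"] by simp
    moreover have "exp ((- a + b * l) + (- b) * z) * exp (a + b * (z - l)) = 1"
      by (simp add: exp_add[symmetric] algebra_simps)
    ultimately show ?thesis
      by (metis (no_types, lifting) add_uminus_conv_diff mult.assoc mult_1)
  qed
  then show ?thesis
    unfolding exp_quasi_periods_def by blast
qed

lemma exp_quasi_periods_of_int:
  assumes "l \<in> exp_quasi_periods f"
  shows "of_int m * l \<in> exp_quasi_periods f"
proof -
  have nat: "of_nat m * l \<in> exp_quasi_periods f" for m
  proof (induction m)
    case 0
    show ?case
      by (auto simp: exp_quasi_periods_def intro!: exI[of _ 0])
  next
    case (Suc m)
    then show ?case
      using exp_quasi_periods_add[OF assms Suc] by (simp add: algebra_simps)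
  qed
  show ?thesis
    using nat exp_quasi_periods_minus[OF nat]
    by (cases m rule: int_cases2) auto
qed

lemma exp_quasi_periods_lattice:
  assumes "1 \<in> exp_quasi_periods f" "\<tau> \<in> exp_quasi_periods f" "l \<in> period_lattice \<tau>"
  obtains a b where "\<And>z. f (z + l) = exp (a + b * z) * f z"
proof -
  have "l \<in> exp_quasi_periods f"
    using assms(3)
  proof (rule period_latticeE)
    fix m n
    assume "l = of_int m + of_int n * \<tau>"
    then show ?thesis
      using exp_quasi_periods_add[OF exp_quasi_periods_of_int[OF assms(1), of m] exp_quasi_periods_of_int[OF assms(2), of n]]
      by simp
  qed
  then show ?thesis
    using that unfolding exp_quasi_periods_def by blast
qed

text \<open>Every point is a lattice translate of one in the compact fundamental parallelogram.
  Periodicity is asked of the norm because \<open>Theta_space_0_trivial\<close> applies this to a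
  function with unimodular multipliers.\<close>

lemma bounded_if_norm_doubly_periodic:
  fixes g :: "complex \<Rightarrow> complex"
  assumes tau: "Im \<tau> > 0" and cont: "continuous_on UNIV g"
    and 1: "\<And>z. norm (g (z + 1)) = norm (g z)" and 2: "\<And>z. norm (g (z + \<tau>)) = norm (g z)"
  shows "bounded (range g)"
proof -
  define K where "K = (\<lambda>(x, y). of_real x + of_real y * \<tau>) ` ({0..1::real} \<times> {0..1::real})"
  have "compact K"
    unfolding K_def by (intro compact_continuous_image compact_Times continuous_intros)
      (auto simp: case_prod_unfold intro!: continuous_intros)
  then have "bounded (g ` K)"
    by (intro compact_imp_bounded compact_continuous_image continuous_on_subset[OF cont]) auto
  then obtain B where B: "\<And>z. z \<in> K \<Longrightarrow> norm (g z) \<le> B"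
    unfolding bounded_iff by auto
  have n1: "norm (g (z + of_nat k * 1)) = norm (g z)" for z k
  proof (induction k)
    case (Suc k)
    then show ?case
      using 1[of "z + of_nat k"] by (simp add: add_ac)
  qed simp
  have n2: "norm (g (z + of_nat k * \<tau>)) = norm (g z)" for z k
  proof (induction k)
    case (Suc k)
    then show ?case
      using 2[of "z + of_nat k * \<tau>"] by (simp add: ring_distribs add_ac)
  qed simp
  have i1: "norm (g (z + of_int k)) = norm (g z)" for z k
    using n1[of z "nat k"] n1[of "z + of_int k" "nat (- k)"] by (cases "k \<ge> 0") (auto simp: of_nat_nat)
  have i2: "norm (g (z + of_int k * \<tau>)) = norm (g z)" for z k
    using n2[of z "nat k"] n2[of "z + of_int k * \<tau>" "nat (- k)"] by (cases "k \<ge> 0") (auto simp: of_nat_nat)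
  have "norm (g z) \<le> B" for z
  proof -
    define y where "y = Im z / Im \<tau>"
    define x where "x = Re z - y * Re \<tau>"
    have z: "z = of_real x + of_real y * \<tau>"
      using tau by (auto simp: complex_eq_iff x_def y_def)
    define w where "w = of_real (frac x) + of_real (frac y) * \<tau>"
    have "z = w + of_int \<lfloor>x\<rfloor> + of_int \<lfloor>y\<rfloor> * \<tau>"
      by (simp add: z w_def frac_def algebra_simps)
    then have "norm (g z) = norm (g w)"
      by (simp only: i1 i2)
    moreover have "w \<in> K"
      unfolding K_def w_def by (rule image_eqI[of _ _ "(frac x, frac y)"]) (auto simp: frac_lt_1 less_imp_le)
    ultimately show ?thesis
      using B by metis
  qed
  then show ?thesis
    unfolding bounded_iff by auto
qed

text \<open>The infinite q-Pochhammer symbol (w; q).\<close>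

definition qpoch :: "complex \<Rightarrow> complex \<Rightarrow> complex" where
  "qpoch q w = (\<Prod>n. 1 - q ^ n * w)"

context
  fixes q :: complex
  assumes q: "norm q < 1"
begin

lemma qpoch_convergent: "convergent_prod (\<lambda>n. 1 - q ^ n * w)"
proof -
  have "summable (\<lambda>n. norm ((1 - q ^ n * w) - 1))"
    using q by (auto simp: norm_mult norm_power intro!: summable_mult2 summable_geometric)
  then show ?thesis
    by (intro abs_convergent_prod_imp_convergent_prod summable_imp_abs_convergent_prod)
qed

lemma qpoch_LIMSEQ: "(\<lambda>n. \<Prod>i<n. 1 - q ^ i * w) \<longlonglongrightarrow> qpoch q w"
  using convergent_prod_LIMSEQ[OF qpoch_convergent] 
  by (simp add: qpoch_def LIMSEQ_lessThan_iff_atMost)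

lemma qpoch_rec: "qpoch q w = (1 - w) * qpoch q (q * w)"
proof (rule LIMSEQ_unique)
  show "(\<lambda>n. \<Prod>i<Suc n. 1 - q ^ i * w) \<longlonglongrightarrow> qpoch q w"
    using qpoch_LIMSEQ[of w] by (rule filterlim_compose[OF _ filterlim_Suc])
  have "(\<Prod>i<Suc n. 1 - q ^ i * w) = (1 - w) * (\<Prod>i<n. 1 - q ^ i * (q * w))" for n
    by (subst prod.lessThan_Suc_shift) (simp add: mult_ac)
  then show "(\<lambda>n. \<Prod>i<Suc n. 1 - q ^ i * w) \<longlonglongrightarrow> (1 - w) * qpoch q (q * w)"
    using tendsto_mult_left[OF qpoch_LIMSEQ[of "q * w"]] by simp
qed

lemma qpoch_eq_0: "qpoch q w = 0 \<Longrightarrow> \<exists>n. q ^ n * w = 1"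
proof (rule ccontr)
  assume "qpoch q w = 0" "\<nexists>n. q ^ n * w = 1"
  then show False
    using prodinf_nonzero[OF qpoch_convergent[of w]] unfolding qpoch_def
    by (metis eq_iff_diff_eq_0)
qed

lemma holomorphic_qpoch: "qpoch q holomorphic_on UNIV"
proof (rule holomorphic_uniform_sequence)
  fix z :: complex
  define A where "A = cball z 1"
  have "uniformly_convergent_on A (\<lambda>N w. \<Prod>n<N. 1 - q ^ n * w)"
  proof (rule uniformly_convergent_on_prod')
    have "summable (\<lambda>n. norm q ^ n * (norm z + 1))"
      using q by (auto intro!: summable_mult2 summable_geometric)
    moreover have "norm w \<le> norm z + 1" if "w \<in> A" for w
      using that norm_triangle_ineq2[of w z] by (simp add: A_def dist_norm norm_minus_commute)
    ultimately show "uniformly_convergent_on A (\<lambda>N w. \<Sum>n<N. norm ((1 - q ^ n * w) - 1))"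
      by (intro Weierstrass_m_test') (auto simp: norm_mult norm_power mult_left_mono)
  qed (auto simp: A_def intro!: continuous_intros)
  then obtain l where l: "uniform_limit A (\<lambda>N w. \<Prod>n<N. 1 - q ^ n * w) l sequentially"
    by (auto simp: uniformly_convergent_on_def)
  then have "uniform_limit A (\<lambda>N w. \<Prod>n<N. 1 - q ^ n * w) (qpoch q) sequentially"
  proof (rule uniform_limit_cong'[THEN iffD1, rotated 2])
    show "l w = qpoch q w" if "w \<in> A" for w
      using LIMSEQ_unique[OF tendsto_uniform_limitI[OF l that] qpoch_LIMSEQ] .
  qed simp
  then show "\<exists>d>0. cball z d \<subseteq> UNIV \<and> uniform_limit (cball z d) (\<lambda>N w. \<Prod>n<N. 1 - q ^ n * w) (qpoch q) sequentially"
    by (intro exI[of _ 1]) (auto simp: A_def)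
qed (auto intro!: holomorphic_intros)

end

section \<open>The theta function and its zeros\<close>

definition theta_term :: "complex \<Rightarrow> int \<Rightarrow> complex \<Rightarrow> complex" where
  "theta_term \<tau> m z = (-1) powi m *
     exp (2 * of_real pi * \<i> * (of_int m * z + of_int m * (of_int m - 1) / 2 * \<tau>))"

lemma theta_eq_infsum: "theta \<tau> z = (\<Sum>\<^sub>\<infinity>m. theta_term \<tau> m z)"
  by (simp add: theta_def theta_term_def)

section \<open>Convergence and quasi-periods of the theta series\<close>

lemma summable_on_exp_minus_abs: "(\<lambda>m::int. exp (- \<bar>real_of_int m\<bar>)) summable_on UNIV"
proof -
  have s: "(\<lambda>n::nat. exp (- real n)) summable_on UNIV"
  proof (subst summable_on_UNIV_nonneg_real_iff)
    have "summable (\<lambda>n. exp (- 1 :: real) ^ n)"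
      by (rule summable_geometric) simp
    then show "summable (\<lambda>n::nat. exp (- real n))"
      by (simp add: exp_of_nat_mult[symmetric])
  qed simp
  have 1: "(\<lambda>m::int. exp (- \<bar>real_of_int m\<bar>)) summable_on range int"
    by (subst summable_on_reindex) (use s in \<open>auto simp: o_def\<close>)
  have "(\<lambda>m::int. exp (- \<bar>real_of_int m\<bar>)) summable_on (\<lambda>n. - int n) ` UNIV"
    by (subst summable_on_reindex) (use s in \<open>auto simp: o_def inj_def\<close>)
  then have 2: "(\<lambda>m::int. exp (- \<bar>real_of_int m\<bar>)) summable_on (range (\<lambda>n. - int n) - range int)"
    by (rule summable_on_subset_banach) auto
  have "(\<lambda>m::int. exp (- \<bar>real_of_int m\<bar>)) summable_on (range int \<union> (range (\<lambda>n. - int n) - range int))"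
    by (rule summable_on_Un_disjoint[OF 1 2]) auto
  also have "range int \<union> (range (\<lambda>n. - int n) - range int) = UNIV"
    by (auto simp: image_iff) (metis int_cases2)
  finally show ?thesis .
qed

lemma norm_theta_term:
  "norm (theta_term \<tau> m z) = exp (- (2 * pi * (of_int m * Im z + of_int m * (of_int m - 1) / 2 * Im \<tau>)))"
proof -
  have eq: "(of_int m * (of_int m - 1) / 2 :: complex) = of_real (of_int m * (of_int m - 1) / 2)"
    by simp
  have re: "Re (2 * of_real pi * \<i> * (of_int m * z + of_int m * (of_int m - 1) / 2 * \<tau>)) =
    - (2 * pi * (of_int m * Im z + of_int m * (of_int m - 1) / 2 * Im \<tau>))"
    unfolding eq by (simp del: of_real_divide of_real_mult of_real_diff add: ring_distribs)
  have "norm ((-1::complex) powi m) = 1"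
    by (simp add: norm_power_int)
  then show ?thesis
    unfolding theta_term_def norm_mult norm_exp_eq_Re re by simp
qed

lemma norm_theta_term_le:
  assumes tau: "Im \<tau> > 0" and z: "\<bar>Im z\<bar> \<le> R"
  shows "norm (theta_term \<tau> m z) \<le>
    exp ((2 * pi * R + pi * Im \<tau> + 1)\<^sup>2 / (4 * pi * Im \<tau>)) * exp (- \<bar>real_of_int m\<bar>)"
proof -
  define T where "T = pi * Im \<tau>"
  \<comment> \<open>The linear part of the exponent is at most (K - 1) |m|. Completing the square in
    K |m| - T m^2 leaves the summable factor exp(-|m|), which is what the summand 1 is for.\<close>
  define K where "K = 2 * pi * R + T + 1"
  define x where "x = \<bar>real_of_int m\<bar>"
  have T: "T > 0"
    using tau by (simp add: T_def)
  have "- (of_int m * Im z) \<le> x * R"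
    using z by (metis abs_ge_minus_self abs_ge_zero abs_mult mult_left_mono order_trans x_def)
  then have 1: "2 * pi * (- (of_int m * Im z)) \<le> 2 * pi * (x * R)"
    by (intro mult_left_mono) auto
  have 2: "T * of_int m \<le> T * x"
    using T by (simp add: x_def)
  have "0 \<le> (2 * T * x - K)\<^sup>2"
    by simp
  then have "K * x - T * x\<^sup>2 \<le> K\<^sup>2 / (4 * T)"
    using T by (simp add: field_simps power2_eq_square)
  moreover have "- (2 * pi * (of_int m * Im z + of_int m * (of_int m - 1) / 2 * Im \<tau>)) =
      2 * pi * (- (of_int m * Im z)) + T * of_int m - T * x\<^sup>2"
    by (simp add: T_def x_def field_simps power2_eq_square)
  ultimately have "- (2 * pi * (of_int m * Im z + of_int m * (of_int m - 1) / 2 * Im \<tau>)) \<le> K\<^sup>2 / (4 * T) - x"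
    using 1 2 by (simp add: K_def algebra_simps)
  then show ?thesis
    unfolding norm_theta_term exp_add[symmetric] by (simp add: K_def T_def x_def mult_ac)
qed

context
  fixes \<tau> :: complex
  assumes tau: "Im \<tau> > 0"
begin

lemma theta_uniform_limit:
  assumes "bounded A"
  shows "uniform_limit A (\<lambda>X z. \<Sum>m\<in>X. theta_term \<tau> m z) (theta \<tau>) (finite_subsets_at_top UNIV)"
proof -
  obtain R where R: "\<And>z. z \<in> A \<Longrightarrow> norm z \<le> R"
    using assms by (auto simp: bounded_iff)
  have *: "\<bar>Im z\<bar> \<le> R" if "z \<in> A" for z
    using R[OF that] abs_Im_le_cmod[of z] by linarith
  show ?thesis
    unfolding theta_eq_infsum[abs_def]
    by (rule Weierstrass_m_test_general[OF norm_theta_term_le[OF tau *]])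
       (auto intro!: summable_on_cmult_right summable_on_exp_minus_abs)
qed

lemma holomorphic_theta_UNIV: "theta \<tau> holomorphic_on UNIV"
proof -
  have "theta \<tau> field_differentiable (at z)" for z
  proof -
    have "theta \<tau> holomorphic_on ball z 1"
    proof (rule holomorphic_uniform_limit)
      show "uniform_limit (cball z 1) (\<lambda>X z. \<Sum>m\<in>X. theta_term \<tau> m z) (theta \<tau>) (finite_subsets_at_top UNIV)"
        by (rule theta_uniform_limit) auto
    qed (auto simp: theta_term_def intro!: always_eventually continuous_intros holomorphic_intros)
    then show ?thesis
      by (rule holomorphic_on_imp_differentiable_at) auto
  qed
  then show ?thesis
    by (simp add: holomorphic_on_def)
qed

lemma holomorphic_theta [holomorphic_intros]:
  "f holomorphic_on A \<Longrightarrow> (\<lambda>z. theta \<tau> (f z)) holomorphic_on A"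
  using holomorphic_on_compose_gen[of f A "theta \<tau>" UNIV] holomorphic_theta_UNIV by (simp add: o_def)

lemma continuous_on_theta [continuous_intros]:
  "continuous_on A f \<Longrightarrow> continuous_on A (\<lambda>x. theta \<tau> (f x))"
  using continuous_on_compose2[OF holomorphic_on_imp_continuous_on[OF holomorphic_theta_UNIV]] by blast

lemma theta_has_field_derivative: "(theta \<tau> has_field_derivative deriv (theta \<tau>) z) (at z)"
  using holomorphic_theta_UNIV by (auto intro: holomorphic_derivI)

lemma theta_add_1: "theta \<tau> (z + 1) = theta \<tau> z"
proof -
  have "theta_term \<tau> m (z + 1) = theta_term \<tau> m z" for m
    using exp_two_pi_of_int[of m] by (simp add: theta_term_def ring_distribs exp_add)
  then show ?thesis
    by (simp add: theta_eq_infsum)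
qed

lemma theta_add_tau: "theta \<tau> (z + \<tau>) = - exp (- 2 * of_real pi * \<i> * z) * theta \<tau> z"
proof -
  have "theta_term \<tau> m (z + \<tau>) = - exp (- 2 * of_real pi * \<i> * z) * theta_term \<tau> (m + 1) z" for m
  proof -
    have "exp (2 * of_real pi * \<i> * (of_int m * (z + \<tau>) + of_int m * (of_int m - 1) / 2 * \<tau>)) =
      exp (- 2 * of_real pi * \<i> * z) *
      exp (2 * of_real pi * \<i> * (of_int (m + 1) * z + of_int (m + 1) * (of_int (m + 1) - 1) / 2 * \<tau>))"
      unfolding exp_add[symmetric] by (rule arg_cong[of _ _ exp]) (simp add: field_simps)
    then show ?thesis
      unfolding theta_term_def by (simp add: power_int_add)
  qed
  then have "theta \<tau> (z + \<tau>) = - exp (- 2 * of_real pi * \<i> * z) * (\<Sum>\<^sub>\<infinity>m. theta_term \<tau> (m + 1) z)"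
    by (simp add: theta_eq_infsum infsum_cmult_right' infsum_uminus)
  also have "(\<Sum>\<^sub>\<infinity>m. theta_term \<tau> (m + 1) z) = theta \<tau> z"
    unfolding theta_eq_infsum
    by (rule infsum_reindex_bij_betw) (auto intro!: bij_betwI[of _ _ _ "\<lambda>m. m - 1"])
  finally show ?thesis .
qed

text \<open>The reflection m -> 1 - m preserves m (m - 1) / 2 and reverses the sign, so the series
  at 0 equals its own negative.\<close>

lemma theta_0: "theta \<tau> 0 = 0"
proof -
  have "theta_term \<tau> (1 - m) 0 = - theta_term \<tau> m 0" for m
  proof -
    have "(-1::complex) powi (1 - m) = - ((-1) powi m)"
      by (simp add: power_int_diff power_int_minus_one_minus field_simps) 
    moreover have "of_int (1 - m) * (of_int (1 - m) - 1) = (of_int m * (of_int m - 1) :: complex)"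
      by (simp add: algebra_simps)
    ultimately show ?thesis
      unfolding theta_term_def by simp
  qed
  then have "- theta \<tau> 0 = (\<Sum>\<^sub>\<infinity>m. theta_term \<tau> (1 - m) 0)"
    by (simp add: theta_eq_infsum infsum_uminus)
  also have "\<dots> = theta \<tau> 0"
    unfolding theta_eq_infsum
    by (rule infsum_reindex_bij_betw) (auto intro!: bij_betwI[of _ _ _ "\<lambda>m. 1 - m"])
  finally show ?thesis
    by simp
qed

text \<open>The constant Fourier coefficient of \<open>\<theta>\<close> is \<open>1\<close>.\<close>

lemma theta_not_identically_0: "\<exists>z. theta \<tau> z \<noteq> 0"
proof (rule ccontr)
  assume "\<nexists>z. theta \<tau> z \<noteq> 0"
  then have 0: "theta \<tau> = (\<lambda>z. 0)"
    by auto
  have integral: "(theta_term \<tau> m has_contour_integral (if m = 0 then 1 else 0)) (linepath 0 1)" for m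
  proof (cases "m = 0")
    case True
    have "(theta_term \<tau> 0 has_contour_integral (id (pathfinish (linepath 0 1)) - id (pathstart (linepath 0 1)))) (linepath 0 1)"
      by (rule contour_integral_primitive[OF _ valid_path_linepath subset_UNIV]) (auto simp: theta_term_def intro!: derivative_eq_intros)
    then show ?thesis
      using True by simp
  next
    case False
    define f where "f = (\<lambda>z. theta_term \<tau> m z / (2 * of_real pi * \<i> * of_int m))"
    have "(theta_term \<tau> m has_contour_integral (f (pathfinish (linepath 0 1)) - f (pathstart (linepath 0 1)))) (linepath 0 1)"
      using False
      by (intro contour_integral_primitive[OF _ valid_path_linepath subset_UNIV])
         (auto simp: f_def theta_term_def intro!: derivative_eq_intros)
    moreover have "f 1 = f 0"
      using exp_two_pi_of_int[of m] by (simp add: f_def theta_term_def ring_distribs exp_add)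
    ultimately show ?thesis
      using False by simp
  qed
  have u: "uniform_limit (path_image (linepath 0 1)) (\<lambda>X z. \<Sum>m\<in>X. theta_term \<tau> m z) (theta \<tau>) (finite_subsets_at_top UNIV)"
    by (rule theta_uniform_limit) (auto intro: bounded_closed_segment)
  obtain I J where I: "\<And>X. ((\<lambda>z. \<Sum>m\<in>X. theta_term \<tau> m z) has_contour_integral I X) (linepath 0 1)"
    and J: "(theta \<tau> has_contour_integral J) (linepath 0 1)" and lim: "(I \<longlongrightarrow> J) (finite_subsets_at_top UNIV)"
    by (rule uniform_limit_contour_integral_linepath[OF u])
       (auto simp: theta_term_def intro!: continuous_intros)
  have "J = 0"
    using J 0 has_contour_integral_unique[OF _ has_contour_integral_0] by metis
  moreover have "eventually (\<lambda>X. I X = 1) (finite_subsets_at_top UNIV)"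
  proof -
    have "I X = 1" if "finite X" "{0} \<subseteq> X" for X
      using has_contour_integral_unique[OF I has_contour_integral_sum[OF that(1) integral]] that by simp
    then show ?thesis
      unfolding eventually_finite_subsets_at_top by (intro exI[of _ "{0}"]) auto
  qed
  ultimately have "(0::complex) = 1"
    using tendsto_unique[OF finite_subsets_at_top_neq_bot lim tendsto_eventually] by simp
  then show False
    by simp
qed

lemma theta_quasi_periods: "1 \<in> exp_quasi_periods (theta \<tau>)" "\<tau> \<in> exp_quasi_periods (theta \<tau>)"
proof -
  show "1 \<in> exp_quasi_periods (theta \<tau>)"
    unfolding exp_quasi_periods_def using theta_add_1 by (auto intro!: exI[of _ 0])
  have "theta \<tau> (z + \<tau>) = exp (of_real pi * \<i> + (- 2 * of_real pi * \<i>) * z) * theta \<tau> z" for z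
    unfolding theta_add_tau exp_add by simp
  then show "\<tau> \<in> exp_quasi_periods (theta \<tau>)"
    unfolding exp_quasi_periods_def by blast
qed

lemma theta_lattice: "z \<in> period_lattice \<tau> \<Longrightarrow> theta \<tau> z = 0"
  using exp_quasi_periods_lattice[OF theta_quasi_periods] theta_0 by (metis add_0 mult_zero_right)

text \<open>With q = exp(2 pi i tau) and w = exp(2 pi i z) this is (w; q) (q/w; q), the product side
  of Jacobi's triple product identity up to a constant. Its zeros are visible from the
  factors.\<close>

definition jacobi_product :: "complex \<Rightarrow> complex" where
  "jacobi_product z = qpoch (exp (2 * of_real pi * \<i> * \<tau>)) (exp (2 * of_real pi * \<i> * z)) *
     qpoch (exp (2 * of_real pi * \<i> * \<tau>)) (exp (2 * of_real pi * \<i> * (\<tau> - z)))"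

lemma norm_nome: "norm (exp (2 * of_real pi * \<i> * \<tau>)) < 1"
  using tau by (simp add: norm_exp_eq_Re)

lemma holomorphic_jacobi_product: "jacobi_product holomorphic_on UNIV"
proof -
  have *: "(\<lambda>z. qpoch (exp (2 * of_real pi * \<i> * \<tau>)) (f z)) holomorphic_on UNIV" if "f holomorphic_on UNIV" for f
    using holomorphic_on_compose_gen[OF that holomorphic_qpoch[OF norm_nome]] by (simp add: o_def)
  show ?thesis
    unfolding jacobi_product_def[abs_def] by (intro holomorphic_intros *)
qed

lemma jacobi_product_add_1: "jacobi_product (z + 1) = jacobi_product z"
proof -
  have "exp (2 * of_real pi * \<i> * (z + 1)) = exp (2 * of_real pi * \<i> * z)"
    using exp_two_pi_of_int[of 1] by (simp add: ring_distribs exp_add)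
  moreover have "exp (2 * of_real pi * \<i> * (\<tau> - (z + 1))) = exp (2 * of_real pi * \<i> * (\<tau> - z))"
    using exp_two_pi_of_int[of 1] by (simp add: ring_distribs exp_add exp_diff)
  ultimately show ?thesis
    by (simp add: jacobi_product_def)
qed

lemma jacobi_product_add_tau: "jacobi_product (z + \<tau>) = - exp (- 2 * of_real pi * \<i> * z) * jacobi_product z"
proof -
  define q where "q = exp (2 * of_real pi * \<i> * \<tau>)"
  define w where "w = exp (2 * of_real pi * \<i> * z)"
  have q: "norm q < 1"
    unfolding q_def by (rule norm_nome)
  have w: "w \<noteq> 0"
    by (simp add: w_def)
  have 1: "exp (2 * of_real pi * \<i> * (z + \<tau>)) = q * w"
    by (simp add: q_def w_def exp_add[symmetric] algebra_simps)
  have 2: "exp (2 * of_real pi * \<i> * (\<tau> - (z + \<tau>))) = 1 / w"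
    by (simp add: w_def exp_minus field_simps)
  have 3: "exp (2 * of_real pi * \<i> * (\<tau> - z)) = q * (1 / w)"
    by (simp add: q_def w_def exp_diff ring_distribs)
  have 4: "exp (- 2 * of_real pi * \<i> * z) = 1 / w"
    by (simp add: w_def exp_minus field_simps)
  have "qpoch q (q * w) * qpoch q (1 / w) = - (1 / w) * (qpoch q w * qpoch q (q * (1 / w)))"
    unfolding qpoch_rec[OF q, of w] qpoch_rec[OF q, of "1 / w"] using w by (simp add: field_simps)
  then show ?thesis
    unfolding jacobi_product_def q_def[symmetric] w_def[symmetric] 1 2 3 4 .
qed

lemma jacobi_product_quasi_periods:
  "1 \<in> exp_quasi_periods jacobi_product" "\<tau> \<in> exp_quasi_periods jacobi_product"
proof -
  show "1 \<in> exp_quasi_periods jacobi_product"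
    unfolding exp_quasi_periods_def using jacobi_product_add_1 by (auto intro!: exI[of _ 0])
  have "jacobi_product (z + \<tau>) = exp (of_real pi * \<i> + (- 2 * of_real pi * \<i>) * z) * jacobi_product z" for z
    unfolding jacobi_product_add_tau exp_add by simp
  then show "\<tau> \<in> exp_quasi_periods jacobi_product"
    unfolding exp_quasi_periods_def by blast
qed

lemma jacobi_product_zero:
  assumes "jacobi_product z = 0"
  shows "z \<in> period_lattice \<tau>"
proof -
  have *: "\<exists>n::nat. of_nat n * \<tau> + x \<in> \<int>" 
    if zero: "qpoch (exp (2 * of_real pi * \<i> * \<tau>)) (exp (2 * of_real pi * \<i> * x)) = 0" for x
  proof -
    obtain n where "exp (2 * of_real pi * \<i> * \<tau>) ^ n * exp (2 * of_real pi * \<i> * x) = 1"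
      using qpoch_eq_0[OF norm_nome zero] by auto
    moreover have "exp (2 * of_real pi * \<i> * \<tau>) ^ n * exp (2 * of_real pi * \<i> * x) = 
        exp (2 * of_real pi * \<i> * (of_nat n * \<tau> + x))"
      by (simp add: exp_of_nat_mult[symmetric] exp_add[symmetric] algebra_simps)
    ultimately obtain k where "of_nat n * \<tau> + x = of_int k"
      using exp_two_pi_eq_1 by metis
    then show ?thesis
      by (metis Ints_of_int)
  qed
  have "(\<exists>n::nat. of_nat n * \<tau> + z \<in> \<int>) \<or> (\<exists>n::nat. of_nat n * \<tau> + (\<tau> - z) \<in> \<int>)"
    using assms *[of z] *[of "\<tau> - z"] by (auto simp: jacobi_product_def)
  then show ?thesis
  proof (elim disjE exE Ints_cases)
    fix n k assume "of_nat n * \<tau> + z = of_int k"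
    then show ?thesis
      by (intro period_latticeI[of _ k "- int n"]) (simp add: algebra_simps)
  next
    fix n k assume "of_nat n * \<tau> + (\<tau> - z) = of_int k"
    then show ?thesis
      by (intro period_latticeI[of _ "- k" "int n + 1"]) (simp add: algebra_simps)
  qed
qed

text \<open>The first factor 1 - w carries the zero at 0. The remaining product has the value
  \<open>qpoch q q\<close> squared there, which is nonzero since |q| < 1, so the zero is
  simple.\<close>

lemma jacobi_product_0: "jacobi_product 0 = 0" "deriv jacobi_product 0 \<noteq> 0"
proof -
  define q where "q = exp (2 * of_real pi * \<i> * \<tau>)"
  define R where "R = (\<lambda>z. qpoch q (q * exp (2 * of_real pi * \<i> * z)) * qpoch q (exp (2 * of_real pi * \<i> * (\<tau> - z))))"
  have q: "norm q < 1"
    unfolding q_def by (rule norm_nome)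
  have eq: "jacobi_product = (\<lambda>z. (1 - exp (2 * of_real pi * \<i> * z)) * R z)"
    unfolding jacobi_product_def q_def[symmetric] R_def by (subst qpoch_rec[OF q]) (simp add: mult_ac)
  then show "jacobi_product 0 = 0"
    by simp
  have hol: "(\<lambda>z. qpoch q (f z)) holomorphic_on UNIV" if "f holomorphic_on UNIV" for f
    using holomorphic_on_compose_gen[OF that holomorphic_qpoch[OF q]] by (simp add: o_def)
  have "R holomorphic_on UNIV"
    unfolding R_def by (intro holomorphic_intros hol)
  then have R: "(R has_field_derivative deriv R 0) (at 0)"
    by (auto intro: holomorphic_derivI)
  have "(jacobi_product has_field_derivative - (2 * of_real pi * \<i>) * R 0) (at 0)"
    unfolding eq by (auto intro!: derivative_eq_intros R)
  then have "deriv jacobi_product 0 = - (2 * of_real pi * \<i>) * R 0"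
    by (rule DERIV_imp_deriv)
  moreover have "qpoch q q \<noteq> 0"
  proof
    assume "qpoch q q = 0"
    then obtain n where "q ^ n * q = 1"
      using qpoch_eq_0[OF q] by auto
    then have "norm q ^ Suc n = 1"
      by (metis norm_one norm_power power_Suc2)
    then show False
      using q power_less_one_iff[of "norm q" "Suc n"] by simp
  qed
  then have "R 0 \<noteq> 0"
    by (simp add: R_def q_def)
  ultimately show "deriv jacobi_product 0 \<noteq> 0"
    by simp
qed

lemma jacobi_product_lattice:
  assumes "l \<in> period_lattice \<tau>"
  shows "jacobi_product l = 0" "deriv jacobi_product l \<noteq> 0"
proof -
  obtain a b where *: "\<And>z. jacobi_product (z + l) = exp (a + b * z) * jacobi_product z"
    using exp_quasi_periods_lattice[OF jacobi_product_quasi_periods assms] by blast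
  show "jacobi_product l = 0"
    using *[of 0] jacobi_product_0 by simp
  have d: "(jacobi_product has_field_derivative deriv jacobi_product z) (at z)" for z
    using holomorphic_jacobi_product by (auto intro: holomorphic_derivI)
  have "((\<lambda>z. jacobi_product (z + l)) has_field_derivative deriv jacobi_product l) (at 0)"
    using DERIV_shift[of jacobi_product "deriv jacobi_product l" 0 l] d[of l] by simp
  moreover have "((\<lambda>z. exp (a + b * z) * jacobi_product z) has_field_derivative exp a * deriv jacobi_product 0) (at 0)"
    by (auto intro!: derivative_eq_intros d simp: jacobi_product_0)
  ultimately have "deriv jacobi_product l = exp a * deriv jacobi_product 0"
    unfolding * by (rule DERIV_unique)
  then show "deriv jacobi_product l \<noteq> 0"
    using jacobi_product_0 by simp
qed

text \<open>\<open>theta\<close> vanishes at the zeros of the product, which are simple, so the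
  quotient is entire. Both functions have the same multipliers, hence the quotient is elliptic and
  constant by Liouville; the constant is nonzero because \<open>theta\<close> is not identically
  zero.\<close>

lemma theta_eq_jacobi_product:
  obtains C where "C \<noteq> 0" "theta \<tau> = (\<lambda>z. C * jacobi_product z)"
proof -
  obtain g where g: "g holomorphic_on UNIV" "\<And>z. theta \<tau> z = g z * jacobi_product z"
    by (rule division_by_simple_zeros[OF holomorphic_theta_UNIV holomorphic_jacobi_product])
       (use jacobi_product_zero jacobi_product_lattice theta_lattice in auto)
  have cont: "continuous_on UNIV g"
    using g(1) by (rule holomorphic_on_imp_continuous_on)
  have eq: "g' z = g z" if "continuous_on UNIV g'" "\<And>z. jacobi_product z \<noteq> 0 \<Longrightarrow> g' z = g z" for g' z
    using eq_off_simple_zeros[OF holomorphic_jacobi_product _ that(1) cont that(2)]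
      jacobi_product_lattice jacobi_product_zero by blast
  have "g (z + 1) = g z" for z
  proof (rule eq[of "\<lambda>z. g (z + 1)"])
    show "continuous_on UNIV (\<lambda>z. g (z + 1))"
      by (intro continuous_on_compose2[OF cont] continuous_intros) auto
    show "g (z + 1) = g z" if "jacobi_product z \<noteq> 0" for z
      using g(2)[of "z + 1"] g(2)[of z] that by (simp add: theta_add_1 jacobi_product_add_1)
  qed
  moreover have "g (z + \<tau>) = g z" for z
  proof (rule eq[of "\<lambda>z. g (z + \<tau>)"])
    show "continuous_on UNIV (\<lambda>z. g (z + \<tau>))"
      by (intro continuous_on_compose2[OF cont] continuous_intros) auto
    show "g (z + \<tau>) = g z" if "jacobi_product z \<noteq> 0" for z
      using g(2)[of "z + \<tau>"] g(2)[of z] that by (simp add: theta_add_tau jacobi_product_add_tau)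
  qed
  ultimately have "bounded (range g)"
    by (intro bounded_if_norm_doubly_periodic[OF tau cont]) auto
  then obtain C where C: "\<And>z. g z = C"
    using Liouville_theorem[OF g(1)] by (auto simp: constant_on_def)
  have "theta \<tau> = (\<lambda>z. C * jacobi_product z)"
    using g(2) C by auto
  moreover have "C \<noteq> 0"
    using theta_not_identically_0 calculation by auto
  ultimately show ?thesis
    using that by blast
qed

lemma theta_eq_0_iff: "theta \<tau> z = 0 \<longleftrightarrow> z \<in> period_lattice \<tau>"
  using theta_eq_jacobi_product jacobi_product_zero theta_lattice by (metis mult_eq_0_iff)

lemma deriv_theta_nonzero:
  assumes "theta \<tau> z = 0"
  shows "deriv (theta \<tau>) z \<noteq> 0"
proof -
  obtain C where C: "C \<noteq> 0" "theta \<tau> = (\<lambda>z. C * jacobi_product z)"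
    by (rule theta_eq_jacobi_product)
  have "jacobi_product field_differentiable (at z)"
    using holomorphic_jacobi_product by (simp add: holomorphic_on_def)
  then have "deriv (theta \<tau>) z = C * deriv jacobi_product z"
    unfolding C by (rule deriv_cmult)
  then show ?thesis
    using C jacobi_product_lattice assms theta_eq_0_iff by simp
qed

end

section \<open>Theta functions of order n\<close>

lemma Theta_spaceI:
  assumes "f holomorphic_on UNIV" "\<And>z. f (z + 1) = f z"
    "\<And>z. f (z + \<tau>) = (-1) ^ n * exp (- 2 * of_real pi * \<i> * (of_nat n * z - c)) * f z"
  shows "f \<in> Theta_space n c \<tau>"
  using assms by (simp add: Theta_space_def)

lemma Theta_spaceD:
  assumes "f \<in> Theta_space n c \<tau>"
  shows "f holomorphic_on UNIV" "f (z + 1) = f z"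
    "f (z + \<tau>) = (-1) ^ n * exp (- 2 * of_real pi * \<i> * (of_nat n * z - c)) * f z"
  using assms by (simp_all add: Theta_space_def)

lemma Theta_space_add:
  "f \<in> Theta_space n c \<tau> \<Longrightarrow> g \<in> Theta_space n c \<tau> \<Longrightarrow> (\<lambda>z. f z + g z) \<in> Theta_space n c \<tau>"
  unfolding Theta_space_def by (auto intro!: holomorphic_intros simp: ring_distribs)

lemma Theta_space_cmult:
  "f \<in> Theta_space n c \<tau> \<Longrightarrow> (\<lambda>z. a * f z) \<in> Theta_space n c \<tau>"
  unfolding Theta_space_def by (auto intro!: holomorphic_intros)

lemma Theta_space_diff:
  "f \<in> Theta_space n c \<tau> \<Longrightarrow> g \<in> Theta_space n c \<tau> \<Longrightarrow> (\<lambda>z. f z - g z) \<in> Theta_space n c \<tau>"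
  using Theta_space_add[of f n c \<tau> "\<lambda>z. (-1) * g z"] Theta_space_cmult[of g n c \<tau> "-1"] by simp

lemma Theta_space_0: "(\<lambda>z. 0) \<in> Theta_space n c \<tau>"
  by (rule Theta_spaceI) auto

lemma Theta_space_sum:
  "(\<And>i. i \<in> I \<Longrightarrow> f i \<in> Theta_space n c \<tau>) \<Longrightarrow> (\<lambda>z. \<Sum>i\<in>I. f i z) \<in> Theta_space n c \<tau>"
  by (induction I rule: infinite_finite_induct) (auto intro: Theta_space_0 Theta_space_add)

lemma Theta_space_mult:
  assumes "f \<in> Theta_space m a \<tau>" "g \<in> Theta_space n b \<tau>"
  shows "(\<lambda>z. f z * g z) \<in> Theta_space (m + n) (a + b) \<tau>"
proof (rule Theta_spaceI)
  show "(\<lambda>z. f z * g z) holomorphic_on UNIV"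
    using assms by (auto intro!: holomorphic_intros dest: Theta_spaceD)
  show "f (z + 1) * g (z + 1) = f z * g z" for z
    using assms by (simp add: Theta_spaceD)
  have "exp (- 2 * of_real pi * \<i> * (of_nat (m + n) * z - (a + b))) =
      exp (- 2 * of_real pi * \<i> * (of_nat m * z - a)) * exp (- 2 * of_real pi * \<i> * (of_nat n * z - b))" for z
    unfolding exp_add[symmetric] by (rule arg_cong[of _ _ exp]) (simp add: algebra_simps)
  then show "f (z + \<tau>) * g (z + \<tau>) =
      (-1) ^ (m + n) * exp (- 2 * of_real pi * \<i> * (of_nat (m + n) * z - (a + b))) * (f z * g z)" for z
    using Theta_spaceD(3)[OF assms(1)] Theta_spaceD(3)[OF assms(2)] by (simp add: power_add)
qed

lemma Theta_space_quasi_periods: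
  assumes "f \<in> Theta_space n c \<tau>"
  shows "1 \<in> exp_quasi_periods f" "\<tau> \<in> exp_quasi_periods f"
proof -
  show "1 \<in> exp_quasi_periods f"
    unfolding exp_quasi_periods_def using Theta_spaceD(2)[OF assms] by (auto intro!: exI[of _ 0])
  have "(-1) ^ n = exp (of_nat n * (of_real pi * \<i>))"
    by (simp only: exp_of_nat_mult exp_pi_i)
  then have "f (z + \<tau>) = exp ((of_nat n * (of_real pi * \<i>) + 2 * of_real pi * \<i> * c) +
      (- 2 * of_real pi * \<i> * of_nat n) * z) * f z" for z
    unfolding Theta_spaceD(3)[OF assms] by (simp add: exp_add[symmetric] algebra_simps)
  then show "\<tau> \<in> exp_quasi_periods f"
    unfolding exp_quasi_periods_def by blast
qed

lemma Theta_space_zero_lattice: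
  assumes "f \<in> Theta_space n c \<tau>" "f v = 0" "w - v \<in> period_lattice \<tau>"
  shows "f w = 0"
proof -
  obtain a b where "\<And>z. f (z + (w - v)) = exp (a + b * z) * f z"
    using exp_quasi_periods_lattice[OF Theta_space_quasi_periods[OF assms(1)] assms(3)] by blast
  from this[of v] show ?thesis
    using assms(2) by simp
qed

text \<open>Lagrange interpolation for theta functions: n - 1 zeros lie at the other nodes, and the
  factor with \<open>\<delta>\<close> supplies the last one, at v_k - delta. This gives every basis
  element the same character, the sum of the nodes minus delta.\<close>

definition lagrange_theta :: "complex \<Rightarrow> 'i set \<Rightarrow> ('i \<Rightarrow> complex) \<Rightarrow> complex \<Rightarrow> 'i \<Rightarrow> complex \<Rightarrow> complex" where
  "lagrange_theta \<tau> I v \<delta> k z = theta \<tau> (z - v k + \<delta>) / theta \<tau> \<delta> *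
     ((\<Prod>m\<in>I-{k}. theta \<tau> (z - v m)) / (\<Prod>m\<in>I-{k}. theta \<tau> (v k - v m)))"

section \<open>Division by a zero, uniqueness and interpolation\<close>

context
  fixes \<tau> :: complex
  assumes tau: "Im \<tau> > 0"
begin

lemma theta_in_Theta_space: "(\<lambda>z. theta \<tau> (z - v)) \<in> Theta_space 1 v \<tau>"
proof (rule Theta_spaceI)
  show "(\<lambda>z. theta \<tau> (z - v)) holomorphic_on UNIV"
    by (intro holomorphic_theta[OF tau] holomorphic_intros)
  show "theta \<tau> (z + 1 - v) = theta \<tau> (z - v)" for z
    using theta_add_1[OF tau, of "z - v"] by (simp add: algebra_simps)
  show "theta \<tau> (z + \<tau> - v) = (-1) ^ 1 * exp (- 2 * of_real pi * \<i> * (of_nat 1 * z - v)) * theta \<tau> (z - v)" for z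
    using theta_add_tau[OF tau, of "z - v"] by (simp add: algebra_simps)
qed

lemma prod_theta_in_Theta_space:
  assumes "finite I"
  shows "(\<lambda>z. \<Prod>i\<in>I. theta \<tau> (z - v i)) \<in> Theta_space (card I) (\<Sum>i\<in>I. v i) \<tau>"
  using assms
proof (induction I)
  case empty
  show ?case
    by (rule Theta_spaceI) auto
next
  case (insert i I)
  then show ?case
    using Theta_space_mult[OF theta_in_Theta_space[of "v i"] insert.IH] by simp
qed

text \<open>A zero at v spreads over v + lattice, which is exactly the set of simple zeros of
  theta(z - v). Dividing the multipliers lowers the order by 1 and the character by v.\<close>

lemma Theta_space_divide:
  assumes f: "f \<in> Theta_space (Suc n) c \<tau>" and v: "f v = 0"
  obtains g where "g \<in> Theta_space n (c - v) \<tau>" "\<And>z. f z = g z * theta \<tau> (z - v)"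
proof -
  define h where "h = (\<lambda>z. theta \<tau> (z - v))"
  have h: "h holomorphic_on UNIV"
    unfolding h_def by (intro holomorphic_theta[OF tau] holomorphic_intros)
  have simple: "deriv h z \<noteq> 0" if "h z = 0" for z
  proof -
    have "(h has_field_derivative deriv (theta \<tau>) (z - v)) (at z)"
    proof -
      have "((\<lambda>z. z - v) has_field_derivative 1) (at z)"
        by (auto intro!: derivative_eq_intros)
      from DERIV_chain2[OF _ this, of "theta \<tau>" "deriv (theta \<tau>) (z - v)"] show ?thesis
        using theta_has_field_derivative[OF tau] by (simp add: h_def)
    qed
    then show ?thesis
      using deriv_theta_nonzero[OF tau, of "z - v"] that by (simp add: DERIV_imp_deriv h_def)
  qed
  have zero: "f z = 0" if "h z = 0" for z
    using that Theta_space_zero_lattice[OF f v] by (simp add: h_def theta_eq_0_iff[OF tau])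
  obtain g where g: "g holomorphic_on UNIV" "\<And>z. f z = g z * h z"
    using division_by_simple_zeros[OF Theta_spaceD(1)[OF f] h simple zero] by blast
  have cont: "continuous_on UNIV g"
    using g(1) by (rule holomorphic_on_imp_continuous_on)
  have eq: "f z = g z"
    if "continuous_on UNIV f" "continuous_on UNIV g" "\<And>z. h z \<noteq> 0 \<Longrightarrow> f z = g z"
    for f g :: "complex \<Rightarrow> complex" and z
    using eq_off_simple_zeros[OF h simple that] .
  have "g \<in> Theta_space n (c - v) \<tau>"
  proof (rule Theta_spaceI)
    show "g (z + 1) = g z" for z
    proof (rule eq[of "\<lambda>z. g (z + 1)" g])
      show "continuous_on UNIV (\<lambda>z. g (z + 1))"
        by (intro continuous_on_compose2[OF cont] continuous_intros) auto
      show "g (z + 1) = g z" if "h z \<noteq> 0" for z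
        using Theta_spaceD(2)[OF f, of z] that Theta_spaceD(2)[OF theta_in_Theta_space, of z v]
        by (simp add: g(2) h_def)
    qed (rule cont)
    show "g (z + \<tau>) = (-1) ^ n * exp (- 2 * of_real pi * \<i> * (of_nat n * z - (c - v))) * g z" for z
    proof (rule eq[of "\<lambda>z. g (z + \<tau>)" "\<lambda>z. (-1) ^ n * exp (- 2 * of_real pi * \<i> * (of_nat n * z - (c - v))) * g z"])
      show "continuous_on UNIV (\<lambda>z. g (z + \<tau>))"
        by (intro continuous_on_compose2[OF cont] continuous_intros) auto
      show "continuous_on UNIV (\<lambda>z. (-1) ^ n * exp (- 2 * of_real pi * \<i> * (of_nat n * z - (c - v))) * g z)"
        by (intro continuous_intros cont)
      show "g (z + \<tau>) = (-1) ^ n * exp (- 2 * of_real pi * \<i> * (of_nat n * z - (c - v))) * g z" if "h z \<noteq> 0" for z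
      proof -
        have "exp (- 2 * of_real pi * \<i> * (of_nat (Suc n) * z - c)) =
            exp (- 2 * of_real pi * \<i> * (of_nat n * z - (c - v))) * exp (- 2 * of_real pi * \<i> * (z - v))"
          unfolding exp_add[symmetric] by (rule arg_cong[of _ _ exp]) (simp add: algebra_simps)
        moreover have "h (z + \<tau>) = - exp (- 2 * of_real pi * \<i> * (z - v)) * h z"
          using Theta_spaceD(3)[OF theta_in_Theta_space, of z v] by (simp add: h_def)
        moreover have "g (z + \<tau>) * h (z + \<tau>) =
            (-1) ^ Suc n * exp (- 2 * of_real pi * \<i> * (of_nat (Suc n) * z - c)) * (g z * h z)"
          using Theta_spaceD(3)[OF f, of z] by (simp only: g(2))
        ultimately show ?thesis
          using that by simp
      qed
    qed
  qed (rule g(1))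
  then show ?thesis
    using that g(2) unfolding h_def by blast
qed

lemma Theta_space_0_trivial:
  assumes f: "f \<in> Theta_space 0 c \<tau>" and c: "c \<notin> period_lattice \<tau>"
  shows "f z = 0"
proof -
  \<comment> \<open>This \<open>r\<close> makes c + r tau real, so both multipliers of
    \<open>h\<close> are unimodular and \<open>h\<close> is a bounded entire function. If its
    constant value were nonzero, both multipliers would be 1, making r and c + r tau integers and c
    a period.\<close>
  define r where "r = - Im c / Im \<tau>"
  define h where "h = (\<lambda>z. f z * exp (2 * of_real pi * \<i> * (of_real r * z)))"
  have h: "h holomorphic_on UNIV"
    unfolding h_def by (intro holomorphic_intros Theta_spaceD(1)[OF f])
  have 1: "h (z + 1) = exp (2 * of_real pi * \<i> * of_real r) * h z" for z
    by (simp add: h_def Theta_spaceD(2)[OF f] exp_add ring_distribs)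
  have 2: "h (z + \<tau>) = exp (2 * of_real pi * \<i> * (c + of_real r * \<tau>)) * h z" for z
    using Theta_spaceD(3)[OF f, of z] by (simp add: h_def exp_add ring_distribs)
  have real: "Im (c + of_real r * \<tau>) = 0"
    using tau by (simp add: r_def)
  have "bounded (range h)"
  proof (rule bounded_if_norm_doubly_periodic[OF tau])
    show "continuous_on UNIV h"
      using h by (rule holomorphic_on_imp_continuous_on)
    show "norm (h (z + 1)) = norm (h z)" for z
      unfolding 1 norm_mult by (simp add: norm_exp_eq_Re)
    have "Re (2 * of_real pi * \<i> * (c + of_real r * \<tau>)) = - 2 * pi * Im (c + of_real r * \<tau>)"
      by (simp add: algebra_simps)
    then show "norm (h (z + \<tau>)) = norm (h z)" for z
      unfolding 2 norm_mult norm_exp_eq_Re real by simp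
  qed
  then obtain C where C: "\<And>z. h z = C"
    using Liouville_theorem[OF h] by (auto simp: constant_on_def)
  have "C = 0"
  proof (rule ccontr)
    assume "C \<noteq> 0"
    then have "exp (2 * of_real pi * \<i> * of_real r) = 1" "exp (2 * of_real pi * \<i> * (c + of_real r * \<tau>)) = 1"
      using 1 2 C by auto
    then obtain k l where "of_real r = (of_int k :: complex)" "c + of_real r * \<tau> = of_int l"
      using exp_two_pi_eq_1 by metis
    then have "c = of_int l + of_int (- k) * \<tau>"
      by (simp add: algebra_simps)
    then show False
      using c period_latticeI by blast
  qed
  then show ?thesis
    using C[of z] by (simp add: h_def)
qed

text \<open>Dividing out all zeros leaves a function of order 0 whose character is c minus the sum
  of the v_i. As this is not a period, the function is zero.\<close>

lemma Theta_space_unique: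
  assumes "finite I" and "f \<in> Theta_space (card I) c \<tau>"
    and "\<And>i j. i \<in> I \<Longrightarrow> j \<in> I \<Longrightarrow> i \<noteq> j \<Longrightarrow> v i - v j \<notin> period_lattice \<tau>"
    and "\<And>i. i \<in> I \<Longrightarrow> f (v i) = 0" and "(\<Sum>i\<in>I. v i) - c \<notin> period_lattice \<tau>"
  shows "f z = 0"
  using assms
proof (induction I arbitrary: f c z)
  case empty
  then show ?case
    using Theta_space_0_trivial[of f c] by simp
next
  case (insert i I)
  obtain g where g: "g \<in> Theta_space (card I) (c - v i) \<tau>" "\<And>z. f z = g z * theta \<tau> (z - v i)"
    using insert by (auto elim!: Theta_space_divide[of f "card I" c "v i"])
  have "g z = 0"
  proof (rule insert.IH[OF g(1)])
    show "g (v j) = 0" if "j \<in> I" for j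
    proof -
      have "theta \<tau> (v j - v i) \<noteq> 0"
        using insert.prems(2)[of j i] insert.hyps that theta_eq_0_iff[OF tau] by auto
      then show ?thesis
        using insert.prems(3)[of j] that g(2)[of "v j"] by simp
    qed
    show "(\<Sum>i\<in>I. v i) - (c - v i) \<notin> period_lattice \<tau>"
      using insert.prems(4) insert.hyps by (simp add: algebra_simps)
  qed (use insert.prems in auto)
  then show ?case
    by (simp add: g(2))
qed

lemma lagrange_theta_in_Theta_space:
  assumes "finite I" "k \<in> I"
  shows "lagrange_theta \<tau> I v \<delta> k \<in> Theta_space (card I) ((\<Sum>i\<in>I. v i) - \<delta>) \<tau>"
proof -
  have "(\<lambda>z. theta \<tau> (z - (v k - \<delta>)) * (\<Prod>m\<in>I-{k}. theta \<tau> (z - v m))) \<in>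
      Theta_space (1 + card (I - {k})) ((v k - \<delta>) + (\<Sum>i\<in>I-{k}. v i)) \<tau>"
    using assms by (intro Theta_space_mult theta_in_Theta_space prod_theta_in_Theta_space) auto
  also have "1 + card (I - {k}) = card I"
    using assms card_Suc_Diff1 by fastforce
  also have "(v k - \<delta>) + (\<Sum>i\<in>I-{k}. v i) = (\<Sum>i\<in>I. v i) - \<delta>"
    using assms by (simp add: sum_diff1)
  finally have "(\<lambda>z. 1 / (theta \<tau> \<delta> * (\<Prod>m\<in>I-{k}. theta \<tau> (v k - v m))) *
      (theta \<tau> (z - (v k - \<delta>)) * (\<Prod>m\<in>I-{k}. theta \<tau> (z - v m)))) \<in> Theta_space (card I) ((\<Sum>i\<in>I. v i) - \<delta>) \<tau>"
    by (rule Theta_space_cmult)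
  then show ?thesis
    unfolding lagrange_theta_def by (simp add: diff_diff_eq2 diff_add_eq)
qed

lemma lagrange_theta_node:
  assumes "finite I" "k \<in> I" "l \<in> I" "\<delta> \<notin> period_lattice \<tau>"
    and "\<And>i j. i \<in> I \<Longrightarrow> j \<in> I \<Longrightarrow> i \<noteq> j \<Longrightarrow> v i - v j \<notin> period_lattice \<tau>"
  shows "lagrange_theta \<tau> I v \<delta> k (v l) = (if k = l then 1 else 0)"
proof (cases "k = l")
  case True
  have "(\<Prod>m\<in>I-{l}. theta \<tau> (v l - v m)) \<noteq> 0"
    using assms theta_eq_0_iff[OF tau] by (subst prod_zero_iff) auto
  then show ?thesis
    using assms theta_eq_0_iff[OF tau] True by (simp add: lagrange_theta_def)
next
  case False
  have "(\<Prod>m\<in>I-{k}. theta \<tau> (v l - v m)) = 0"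
    using assms False theta_0[OF tau] by (intro prod_zero) (auto intro!: bexI[of _ l])
  then show ?thesis
    using False by (simp add: lagrange_theta_def)
qed

lemma lagrange_theta_interpolation:
  assumes "finite I" "\<delta> \<notin> period_lattice \<tau>"
    and "\<And>i j. i \<in> I \<Longrightarrow> j \<in> I \<Longrightarrow> i \<noteq> j \<Longrightarrow> v i - v j \<notin> period_lattice \<tau>"
    and f: "f \<in> Theta_space (card I) ((\<Sum>i\<in>I. v i) - \<delta>) \<tau>"
  shows "f z = (\<Sum>k\<in>I. f (v k) * lagrange_theta \<tau> I v \<delta> k z)"
proof -
  define g where "g = (\<lambda>z. f z - (\<Sum>k\<in>I. f (v k) * lagrange_theta \<tau> I v \<delta> k z))"
  have "g z = 0"
  proof (rule Theta_space_unique[where f = g and v = v and I = I and c = "(\<Sum>i\<in>I. v i) - \<delta>"])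
    show "g \<in> Theta_space (card I) ((\<Sum>i\<in>I. v i) - \<delta>) \<tau>"
      unfolding g_def using assms(1)
      by (intro Theta_space_diff f Theta_space_sum Theta_space_cmult lagrange_theta_in_Theta_space)
    show "g (v l) = 0" if "l \<in> I" for l
    proof -
      have "(\<Sum>k\<in>I. f (v k) * lagrange_theta \<tau> I v \<delta> k (v l)) = (\<Sum>k\<in>I. if k = l then f (v l) else 0)"
        using assms that by (intro sum.cong) (auto simp: lagrange_theta_node)
      then show ?thesis
        using that assms(1) by (simp add: g_def)
    qed
    show "(\<Sum>i\<in>I. v i) - ((\<Sum>i\<in>I. v i) - \<delta>) \<notin> period_lattice \<tau>"
      using assms(2) by simp
  qed (use assms in auto)
  then show ?thesis
    by (simp add: g_def)
qed

end

section \<open>Spanning the theta space by pair sums\<close>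

text \<open>The 3 x 3 determinant with rows x, y, z, expanded along x so that its identities are
  plain ring identities.\<close>

definition tri :: "complex^3 \<Rightarrow> complex^3 \<Rightarrow> complex^3 \<Rightarrow> complex" where
  "tri x y z = (let x' = vec_nth x; y' = vec_nth y; z' = vec_nth z in
     x' 1 * (y' 2 * z' 3 - y' 3 * z' 2) + x' 2 * (y' 3 * z' 1 - y' 1 * z' 3) + x' 3 * (y' 1 * z' 2 - y' 2 * z' 1))"

lemma tri_linear:
  "tri (x + x') y z = tri x y z + tri x' y z" "tri (k *s x) y z = k * tri x y z" "tri 0 y z = 0"
  "tri x (y + y') z = tri x y z + tri x y' z" "tri x (k *s y) z = k * tri x y z" "tri x 0 z = 0"
  "tri x y (z + z') = tri x y z + tri x y z'" "tri x y (k *s z) = k * tri x y z" "tri x y 0 = 0"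
  by (simp_all add: tri_def Let_def algebra_simps)

lemma tri_sum_left: "tri (\<Sum>k\<in>K. r k *s x k) y z = (\<Sum>k\<in>K. r k * tri (x k) y z)"
  by (induction K rule: infinite_finite_induct) (simp_all add: tri_linear)

lemma tri_swap: "tri x z y = - tri x y z" "tri y x z = - tri x y z"
  by (simp_all add: tri_def Let_def algebra_simps)

lemma tri_same [simp]: "tri x x z = 0" "tri x y x = 0" "tri x y y = 0"
  by (simp_all add: tri_def Let_def algebra_simps)

lemma tri_cyclic: "tri y z x = tri x y z"
  by (simp add: tri_def Let_def algebra_simps)

lemma tri_nonzero_imp_nonzero:
  assumes "tri x y z \<noteq> 0"
  shows "x \<noteq> 0" "y \<noteq> 0" "z \<noteq> 0"
  using assms by (auto simp: tri_linear)

text \<open>Cramer's rule: these three determinants, divided by \<open>tri a b c\<close>, are the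
  coordinates of v in the basis a, b, c.\<close>

lemma tri_cramer:
  assumes "tri a b c \<noteq> 0" "v \<noteq> 0"
  shows "tri v b c \<noteq> 0 \<or> tri v c a \<noteq> 0 \<or> tri v a b \<noteq> 0"
proof (rule ccontr)
  assume "\<not> ?thesis"
  then have z: "tri v b c = 0" "tri v c a = 0" "tri v a b = 0"
    by auto
  have "tri a b c * vec_nth v k = tri v b c * vec_nth a k + tri v c a * vec_nth b k + tri v a b * vec_nth c k" for k
    using exhaust_3[of k] by (auto simp: tri_def Let_def algebra_simps)
  then have "v $ k = 0" for k
    using z assms(1) by simp
  then show False
    using assms(2) by (simp add: vec_eq_iff)
qed

text \<open>
  The compatibility condition is \<open>pair_sum\<close> with \<open>B = pair_theta\<close>, where \<open>p i\<close> collects the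
  residues at \<open>u\<^sub>i\<close> of the three functions and \<open>\<xi> i\<close> the three derivatives of \<open>u\<^sub>i\<close>.
\<close>

definition pair_sum :: "('i \<Rightarrow> complex^3) \<Rightarrow> ('i \<Rightarrow> 'i \<Rightarrow> complex) \<Rightarrow> ('i \<Rightarrow> complex^3) \<Rightarrow> 'i set \<Rightarrow> complex" where
  "pair_sum p B \<xi> I = (\<Sum>i\<in>I. \<Sum>j\<in>I-{i}. tri (\<xi> i) (p i) (p j) * B i j)"

lemma pair_sum_insert:
  assumes "finite J" "a \<notin> J"
  shows "pair_sum p B \<xi> (insert a J) = pair_sum p B \<xi> J +
    (\<Sum>j\<in>J. tri (\<xi> a) (p a) (p j) * B a j) + (\<Sum>j\<in>J. tri (\<xi> j) (p j) (p a) * B j a)"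
proof -
  have "(\<Sum>j\<in>insert a J-{i}. tri (\<xi> i) (p i) (p j) * B i j) =
      tri (\<xi> i) (p i) (p a) * B i a + (\<Sum>j\<in>J-{i}. tri (\<xi> i) (p i) (p j) * B i j)" if "i \<in> J" for i
  proof -
    have "insert a J - {i} = insert a (J - {i})"
      using that assms by auto
    then show ?thesis
      using assms by simp
  qed
  moreover have "insert a J - {a} = J"
    using assms by auto
  ultimately show ?thesis
    unfolding pair_sum_def using assms by (simp add: sum.distrib)
qed

lemma pair_sum_cong:
  assumes "\<And>i. i \<in> I \<Longrightarrow> p i = p' i" "\<And>i. i \<in> I \<Longrightarrow> \<xi> i = \<xi>' i"
    "\<And>i j. i \<in> I \<Longrightarrow> j \<in> I \<Longrightarrow> i \<noteq> j \<Longrightarrow> B i j = B' i j"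
  shows "pair_sum p B \<xi> I = pair_sum p' B' \<xi>' I"
  unfolding pair_sum_def using assms by (intro sum.cong refl) auto

lemma pair_sum_add: "pair_sum p B (\<lambda>i. \<xi> i + \<xi>' i) I = pair_sum p B \<xi> I + pair_sum p B \<xi>' I"
  unfolding pair_sum_def by (simp add: tri_linear ring_distribs sum.distrib)

lemma pair_sum_linear:
  "pair_sum p B (\<lambda>i. \<Sum>k\<in>K. r k *s \<xi> k i) I = (\<Sum>k\<in>K. r k * pair_sum p B (\<xi> k) I)"
  unfolding pair_sum_def
  by (induction K rule: infinite_finite_induct)
     (simp_all add: tri_linear ring_distribs sum.distrib sum_distrib_left mult_ac)

lemma pair_sum_cmult: "pair_sum p (\<lambda>i j. B i j * k) \<xi> I = pair_sum p B \<xi> I * k"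
  unfolding pair_sum_def sum_distrib_right by (simp add: mult_ac)

text \<open>The product rho(z - u_i) rho(z - u_j) cleared of its denominators. The formula is meant
  for distinct i and j; on the diagonal it would have order n + 1.\<close>

definition pair_theta :: "complex \<Rightarrow> complex \<Rightarrow> 'i set \<Rightarrow> ('i \<Rightarrow> complex) \<Rightarrow> complex \<Rightarrow> 'i \<Rightarrow> 'i \<Rightarrow> complex" where
  "pair_theta \<tau> \<eta> I u z i j = theta \<tau> (z - u i + \<eta>) * theta \<tau> (z - u j + \<eta>) * (\<Prod>m\<in>I-{i,j}. theta \<tau> (z - u m))"

lemma pair_theta_commute: "pair_theta \<tau> \<eta> I u z i j = pair_theta \<tau> \<eta> I u z j i"
  by (simp add: pair_theta_def insert_commute mult_ac)

lemma pair_theta_cong: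
  assumes "\<And>i. i \<in> I \<Longrightarrow> u i = u' i" "i \<in> I" "j \<in> I"
  shows "pair_theta \<tau> \<eta> I u z i j = pair_theta \<tau> \<eta> I u' z i j"
  using assms unfolding pair_theta_def by (intro arg_cong2[of _ _ _ _ "(*)"] prod.cong) auto

definition incongruent_on :: "complex \<Rightarrow> 'i set \<Rightarrow> ('i \<Rightarrow> complex) \<Rightarrow> bool" where
  "incongruent_on \<tau> I u \<longleftrightarrow> (\<forall>i\<in>I. \<forall>j\<in>I. i \<noteq> j \<longrightarrow> u i - u j \<notin> period_lattice \<tau>)"

text \<open>Surjectivity onto the theta space is phrased as a representation of each element, the
  form in which merging two points produces it.\<close>

definition spanning :: "complex \<Rightarrow> complex \<Rightarrow> 'i set \<Rightarrow> ('i \<Rightarrow> complex) \<Rightarrow> ('i \<Rightarrow> complex^3) \<Rightarrow> bool" where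
  "spanning \<tau> \<eta> I u p \<longleftrightarrow> (\<forall>f\<in>Theta_space (card I) ((\<Sum>i\<in>I. u i) - 2 * \<eta>) \<tau>.
     \<exists>\<xi>. \<forall>z. f z = pair_sum p (pair_theta \<tau> \<eta> I u z) \<xi> I)"

lemma spanning_cong:
  assumes "\<And>i. i \<in> I \<Longrightarrow> u i = u' i"
  shows "spanning \<tau> \<eta> I u p = spanning \<tau> \<eta> I u' p"
proof -
  have "pair_sum p (pair_theta \<tau> \<eta> I u z) \<xi> I = pair_sum p (pair_theta \<tau> \<eta> I u' z) \<xi> I" for z \<xi>
    using assms by (intro pair_sum_cong pair_theta_cong) auto
  moreover have "(\<Sum>i\<in>I. u i) = (\<Sum>i\<in>I. u' i)"
    using assms by (intro sum.cong) auto
  ultimately show ?thesis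
    unfolding spanning_def by simp
qed

context
  fixes \<tau> \<eta> :: complex
  assumes tau: "Im \<tau> > 0" and eta: "\<eta> \<notin> period_lattice \<tau>"
begin

lemma pair_theta_in_Theta_space:
  assumes "finite I" "i \<in> I" "j \<in> I" "i \<noteq> j"
  shows "(\<lambda>z. pair_theta \<tau> \<eta> I u z i j) \<in> Theta_space (card I) ((\<Sum>i\<in>I. u i) - 2 * \<eta>) \<tau>"
proof -
  have "(\<lambda>z. theta \<tau> (z - (u i - \<eta>)) * theta \<tau> (z - (u j - \<eta>)) * (\<Prod>m\<in>I-{i,j}. theta \<tau> (z - u m))) \<in>
      Theta_space (1 + 1 + card (I - {i, j})) (((u i - \<eta>) + (u j - \<eta>)) + (\<Sum>m\<in>I-{i,j}. u m)) \<tau>"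
    using assms by (intro Theta_space_mult theta_in_Theta_space prod_theta_in_Theta_space tau) auto
  also have eq: "I - {i, j} = I - {i} - {j}"
    by auto
  also have "1 + 1 + card (I - {i} - {j}) = card I"
    using card_Suc_Diff1[of I i] card_Suc_Diff1[of "I - {i}" j] assms by auto
  also have "((u i - \<eta>) + (u j - \<eta>)) + (\<Sum>m\<in>I-{i}-{j}. u m) = (\<Sum>i\<in>I. u i) - 2 * \<eta>"
    using assms by (simp add: sum_diff1)
  finally show ?thesis
    unfolding pair_theta_def eq by (simp add: diff_diff_eq2 diff_add_eq)
qed

lemma pair_sum_in_Theta_space:
  assumes "finite I"
  shows "(\<lambda>z. pair_sum p (pair_theta \<tau> \<eta> I u z) \<xi> I) \<in> Theta_space (card I) ((\<Sum>i\<in>I. u i) - 2 * \<eta>) \<tau>"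
  unfolding pair_sum_def using assms
  by (intro Theta_space_sum Theta_space_cmult pair_theta_in_Theta_space) auto

lemma spanning_three:
  assumes dist: "a \<noteq> b" "a \<noteq> c" "b \<noteq> c" and p: "tri (p a) (p b) (p c) \<noteq> 0"
    and u: "incongruent_on \<tau> {a, b, c} u"
  shows "spanning \<tau> \<eta> {a, b, c} u p"
  unfolding spanning_def
proof
  let ?I = "{a, b, c}"
  let ?B = "pair_theta \<tau> \<eta> ?I u"
  fix f
  assume f: "f \<in> Theta_space (card ?I) ((\<Sum>i\<in>?I. u i) - 2 * \<eta>) \<tau>"
  define T where "T = tri (p a) (p b) (p c)"
  \<comment> \<open>At u_c - eta the factor theta(z - u_c + eta) kills both products that involve c,
    so only the pair (a, b) survives there; likewise for the other two nodes. The sum of these nodes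
    minus the character is -eta.\<close>
  define \<alpha> where "\<alpha> = f (u c - \<eta>) / ?B (u c - \<eta>) a b"
  define \<beta> where "\<beta> = f (u b - \<eta>) / ?B (u b - \<eta>) a c"
  define \<gamma> where "\<gamma> = f (u a - \<eta>) / ?B (u a - \<eta>) b c"
  define g where "g = (\<lambda>z. f z - (\<alpha> * ?B z a b + \<beta> * ?B z a c + \<gamma> * ?B z b c))"
  have eta': "theta \<tau> (- \<eta>) \<noteq> 0"
    using eta by (simp add: theta_eq_0_iff[OF tau])
  have u': "theta \<tau> (u i - u j) \<noteq> 0" if "i \<in> ?I" "j \<in> ?I" "i \<noteq> j" for i j
    using u that unfolding incongruent_on_def theta_eq_0_iff[OF tau] by blast
  have sets: "?I - {a, b} = {c}" "?I - {a, c} = {b}" "?I - {b, c} = {a}"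
    using dist by auto
  have "g z = 0" for z
  proof (rule Theta_space_unique[where f = g and I = ?I and v = "\<lambda>i. u i - \<eta>" and c = "(\<Sum>i\<in>?I. u i) - 2 * \<eta>"])
    show "g \<in> Theta_space (card ?I) ((\<Sum>i\<in>?I. u i) - 2 * \<eta>) \<tau>"
      unfolding g_def using dist
      by (intro Theta_space_diff f Theta_space_add Theta_space_cmult pair_theta_in_Theta_space) auto
    have nz: "?B (u c - \<eta>) a b \<noteq> 0" "?B (u b - \<eta>) a c \<noteq> 0" "?B (u a - \<eta>) b c \<noteq> 0"
      unfolding pair_theta_def sets using u' eta' dist by auto
    have z: "?B (u a - \<eta>) a b = 0" "?B (u a - \<eta>) a c = 0" "?B (u b - \<eta>) a b = 0" "?B (u b - \<eta>) b c = 0"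
      "?B (u c - \<eta>) a c = 0" "?B (u c - \<eta>) b c = 0"
      unfolding pair_theta_def by (simp_all add: theta_0[OF tau])
    show "g (u i - \<eta>) = 0" if "i \<in> ?I" for i
      using that nz z by (auto simp: g_def \<alpha>_def \<beta>_def \<gamma>_def)
    show "u i - \<eta> - (u j - \<eta>) \<notin> period_lattice \<tau>" if "i \<in> ?I" "j \<in> ?I" "i \<noteq> j" for i j
      using u' that by (simp add: theta_eq_0_iff[OF tau])
    have "(\<Sum>i\<in>?I. u i - \<eta>) - ((\<Sum>i\<in>?I. u i) - 2 * \<eta>) = - \<eta>"
      using dist by simp
    with eta show "(\<Sum>i\<in>?I. u i - \<eta>) - ((\<Sum>i\<in>?I. u i) - 2 * \<eta>) \<notin> period_lattice \<tau>"
      by (simp only: period_lattice_minus_iff not_False_eq_True)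
  qed (use tau in auto)
  then have feq: "f z = \<alpha> * ?B z a b + \<beta> * ?B z a c + \<gamma> * ?B z b c" for z
    by (simp add: g_def)
  \<comment> \<open>Each pair coefficient is hit separately: p c paired with (p a, p b) and p a
    paired with (p b, p c) give T, while p b paired with (p a, p c) gives -T. Every unwanted
    determinant has two equal rows.\<close>
  define \<xi> where "\<xi> = (\<lambda>i. if i = a then (\<alpha> / T) *s p c + (- \<beta> / T) *s p b else if i = b then (\<gamma> / T) *s p a else 0)"
  have "pair_sum p (?B z) \<xi> ?I = f z" for z
  proof -
    have "tri (\<xi> a) (p a) w = \<alpha> / T * tri (p c) (p a) w + - \<beta> / T * tri (p b) (p a) w" for w
      unfolding \<xi>_def tri_linear(1,2)[symmetric] by simp
    moreover have "tri (p c) (p a) (p b) = T" "tri (p b) (p a) (p c) = - T"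
      unfolding T_def by (rule tri_cyclic[symmetric], rule tri_swap)
    ultimately have "tri (\<xi> a) (p a) (p b) = \<alpha>" "tri (\<xi> a) (p a) (p c) = \<beta>"
      using p by (simp_all add: T_def)
    moreover have "tri (\<xi> b) (p b) (p a) = 0" "tri (\<xi> b) (p b) (p c) = \<gamma>"
      using p dist by (simp_all add: \<xi>_def tri_linear T_def)
    moreover have "\<xi> c = 0"
      using dist by (simp add: \<xi>_def)
    moreover have "?I - {a} = {b, c}" "?I - {b} = {a, c}" "?I - {c} = {a, b}"
      using dist by auto
    ultimately show ?thesis
      unfolding pair_sum_def feq using dist by (simp add: tri_linear)
  qed
  then show "\<exists>\<xi>. \<forall>z. f z = pair_sum p (?B z) \<xi> ?I"
    by metis
qed

text \<open>
  When \<open>u N\<close> collides with \<open>u a\<close> modulo the lattice, the configuration degenerates to one with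
  a single point \<open>u a\<close> carrying the residue vector \<open>p a + t p N\<close>.
\<close>

lemma spanning_merge:
  assumes I: "finite I" "a \<in> I" "N \<in> I" "a \<noteq> N"
    and uN: "u N - u a \<in> period_lattice \<tau>"
    and t: "\<And>x. theta \<tau> (x - u N + \<eta>) * theta \<tau> (x - u a) = t * (theta \<tau> (x - u a + \<eta>) * theta \<tau> (x - u N))"
    and u: "incongruent_on \<tau> (I - {N}) u"
    and x: "tri x (p a) (p N) \<noteq> 0"
    and span: "spanning \<tau> \<eta> (I - {N}) u (p(a := p a + t *s p N))"
  shows "spanning \<tau> \<eta> I u p"
  unfolding spanning_def
proof
  let ?B = "pair_theta \<tau> \<eta> I u"
  fix f
  assume f: "f \<in> Theta_space (card I) ((\<Sum>i\<in>I. u i) - 2 * \<eta>) \<tau>"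
  define J where "J = I - {N} - {a}"
  have J: "finite J" "a \<notin> J" "N \<notin> J" "I - {N} = insert a J" "I = insert N (insert a J)"
    using I by (auto simp: J_def)
  have aN: "theta \<tau> (u a - u N) = 0"
    using uN period_lattice_minus_iff[of "u N - u a" \<tau>] by (simp add: theta_eq_0_iff[OF tau])
  have nz: "?B (u a) a N \<noteq> 0"
  proof -
    have "theta \<tau> (u a - u N + \<eta>) \<noteq> 0"
    proof
      assume "theta \<tau> (u a - u N + \<eta>) = 0"
      then have "(u N - u a) + (u a - u N + \<eta>) \<in> period_lattice \<tau>"
        using uN period_lattice_add theta_eq_0_iff[OF tau] by blast
      then show False
        using eta by simp
    qed
    moreover have "theta \<tau> (u a - u m) \<noteq> 0" if "m \<in> I - {a, N}" for m
      using u that I unfolding incongruent_on_def theta_eq_0_iff[OF tau] by auto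
    ultimately show ?thesis
      using eta I by (auto simp: pair_theta_def theta_eq_0_iff[OF tau])
  qed
  \<comment> \<open>At u_a a product for any pair other than {a, N} retains a factor theta(u_a -
    u_a) or theta(u_a - u_N), both zero. The single pair {a, N} therefore adjusts the value at u_a,
    and subtracting it makes \<open>f1\<close> vanish there and at the congruent point u_N.\<close>
  define k where "k = f (u a) / (?B (u a) a N * tri x (p a) (p N))"
  define \<xi>1 where "\<xi>1 = (\<lambda>i. if i = a then k *s x else 0)"
  define f1 where "f1 = (\<lambda>z. f z - pair_sum p (?B z) \<xi>1 I)"
  have "pair_sum p (?B (u a)) \<xi>1 I = f (u a)"
  proof -
    have "pair_sum p (?B (u a)) \<xi>1 I = (\<Sum>j\<in>I-{a}. tri (k *s x) (p a) (p j) * ?B (u a) a j)"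
      unfolding pair_sum_def using I by (subst sum.remove[of _ a]) (auto simp: \<xi>1_def tri_linear)
    also have "\<dots> = tri (k *s x) (p a) (p N) * ?B (u a) a N"
    proof (subst sum.remove[of _ N])
      have "?B (u a) a j = 0" if "j \<in> I - {a} - {N}" for j
      proof -
        have "(\<Prod>m\<in>I-{a,j}. theta \<tau> (u a - u m)) = 0"
          using I that aN by (intro prod_zero) auto
        then show ?thesis
          by (simp add: pair_theta_def)
      qed
      then show "tri (k *s x) (p a) (p N) * ?B (u a) a N +
          (\<Sum>j\<in>I-{a}-{N}. tri (k *s x) (p a) (p j) * ?B (u a) a j) = tri (k *s x) (p a) (p N) * ?B (u a) a N"
        by simp
    qed (use I in auto)
    finally show ?thesis
      using nz x by (simp add: k_def tri_linear)
  qed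
  then have "f1 (u a) = 0"
    by (simp add: f1_def)
  moreover have f1: "f1 \<in> Theta_space (Suc (card (I - {N}))) ((\<Sum>i\<in>I. u i) - 2 * \<eta>) \<tau>"
    unfolding f1_def card_Suc_Diff1[OF I(1,3)] using I
    by (intro Theta_space_diff f pair_sum_in_Theta_space)
  ultimately have "f1 (u N) = 0"
    using Theta_space_zero_lattice uN by blast
  then obtain g where g: "g \<in> Theta_space (card (I - {N})) ((\<Sum>i\<in>I. u i) - 2 * \<eta> - u N) \<tau>"
      "\<And>z. f1 z = g z * theta \<tau> (z - u N)"
    using Theta_space_divide[OF tau f1] by blast
  moreover have "(\<Sum>i\<in>I. u i) - 2 * \<eta> - u N = (\<Sum>i\<in>I-{N}. u i) - 2 * \<eta>"
    using I by (simp add: sum_diff1)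
  ultimately obtain \<xi> where \<xi>: "\<And>z. g z = pair_sum (p(a := p a + t *s p N)) (pair_theta \<tau> \<eta> (I - {N}) u z) \<xi> (I - {N})"
    using span unfolding spanning_def by metis
  \<comment> \<open>Giving N the same vector as a makes the two terms of the pair {a, N} cancel by
    antisymmetry. For every other j the terms of a and N add up to one with p a + t p N, since the
    products for N are t times those for a.\<close>
  define \<xi>2 where "\<xi>2 = \<xi>(N := \<xi> a)"
  have f1_eq: "f1 z = pair_sum p (?B z) \<xi>2 I" for z
  proof -
    let ?q = "p(a := p a + t *s p N)"
    have B1: "pair_theta \<tau> \<eta> (I - {N}) u z i j * theta \<tau> (z - u N) = ?B z i j" if "i \<in> I - {N}" "j \<in> I - {N}" for i j
    proof -
      have "(\<Prod>m\<in>I-{i,j}. theta \<tau> (z - u m)) = theta \<tau> (z - u N) * (\<Prod>m\<in>I-{i,j}-{N}. theta \<tau> (z - u m))"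
        using I that by (intro prod.remove) auto
      moreover have "I - {i, j} - {N} = I - {N} - {i, j}"
        by auto
      ultimately show ?thesis
        by (simp add: pair_theta_def mult_ac)
    qed
    have B2: "?B z N j = t * ?B z a j" if "j \<in> J" for j
    proof -
      have "(\<Prod>m\<in>I-{N,j}. theta \<tau> (z - u m)) = theta \<tau> (z - u a) * (\<Prod>m\<in>J-{j}. theta \<tau> (z - u m))"
      proof -
        have "I - {N, j} - {a} = J - {j}"
          by (auto simp: J_def)
        then show ?thesis
          using I that J by (subst prod.remove[of _ a]) auto
      qed
      moreover have "(\<Prod>m\<in>I-{a,j}. theta \<tau> (z - u m)) = theta \<tau> (z - u N) * (\<Prod>m\<in>J-{j}. theta \<tau> (z - u m))"
      proof -
        have "I - {a, j} - {N} = J - {j}"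
          by (auto simp: J_def)
        then show ?thesis
          using I that J by (subst prod.remove[of _ N]) auto
      qed
      ultimately show ?thesis
        using t[of z] unfolding pair_theta_def by algebra
    qed
    have B2': "?B z j N = t * ?B z j a" if "j \<in> J" for j
      using B2[OF that] by (simp add: pair_theta_commute)
    have "f1 z = pair_sum ?q (?B z) \<xi> (insert a J)"
      unfolding g(2) \<xi> pair_sum_cmult[symmetric] J(4)[symmetric]
      by (rule pair_sum_cong) (auto simp: B1)
    also have "\<dots> = pair_sum p (?B z) \<xi> J + (\<Sum>j\<in>J. tri (\<xi> a) (p a + t *s p N) (p j) * ?B z a j)
        + (\<Sum>j\<in>J. tri (\<xi> j) (p j) (p a + t *s p N) * ?B z j a)"
    proof -
      have "pair_sum ?q (?B z) \<xi> J = pair_sum p (?B z) \<xi> J"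
        using J by (intro pair_sum_cong) auto
      moreover have "?q j = p j" if "j \<in> J" for j
        using J that by auto
      ultimately show ?thesis
        using J by (simp add: pair_sum_insert)
    qed
    also have "\<dots> = pair_sum p (?B z) \<xi>2 I"
    proof -
      have x1: "pair_sum p (?B z) \<xi>2 J = pair_sum p (?B z) \<xi> J"
        using J by (intro pair_sum_cong) (auto simp: \<xi>2_def)
      have x2: "\<xi>2 j = \<xi> j" if "j \<in> J" for j
        using that J by (auto simp: \<xi>2_def)
      have x3: "\<xi>2 N = \<xi> a" "\<xi>2 a = \<xi> a"
        using I by (auto simp: \<xi>2_def)
      have x4: "tri (\<xi> a) (p N) (p a) = - tri (\<xi> a) (p a) (p N)" "?B z N a = ?B z a N"
        by (rule tri_swap, rule pair_theta_commute)
      have NaJ: "N \<notin> insert a J" "finite (insert a J)"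
        using J I by auto
      show ?thesis
        unfolding arg_cong[OF J(5), of "pair_sum p (?B z) \<xi>2"] pair_sum_insert[OF NaJ(2,1)]
          pair_sum_insert[OF J(1,2)] sum.insert[OF J(1,2)] x1 x3 x4
        using x2 B2 B2' by (simp add: tri_linear ring_distribs sum.distrib mult_ac)
    qed
    finally show ?thesis .
  qed
  have "f z = pair_sum p (?B z) (\<lambda>i. \<xi>1 i + \<xi>2 i) I" for z
    unfolding pair_sum_add f1_eq[symmetric] by (simp add: f1_def)
  then show "\<exists>\<xi>. \<forall>z. f z = pair_sum p (?B z) \<xi> I"
    by blast
qed

lemma holomorphic_pair_sum [holomorphic_intros]:
  assumes "\<And>i. (\<lambda>z. u z i) holomorphic_on A" "w holomorphic_on A"
  shows "(\<lambda>z. pair_sum p (pair_theta \<tau> \<eta> I (u z) (w z)) \<xi> I) holomorphic_on A"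
  unfolding pair_sum_def pair_theta_def by (intro holomorphic_intros holomorphic_theta tau assms)

text \<open>
  Lagrange interpolation at \<open>us\<close> exhibits a determinant that equals \<open>1\<close> at \<open>us\<close>, so it vanishes
  only at isolated points of the line through \<open>u0\<close> and \<open>us\<close>.
\<close>

lemma spanning_perturb:
  fixes I :: "'n::finite set" and us u0 :: "'n \<Rightarrow> complex"
  assumes span: "spanning \<tau> \<eta> I us p" and u0: "incongruent_on \<tau> I u0" and I: "I \<noteq> {}" and e: "e > 0"
  obtains z where "norm z < e" "incongruent_on \<tau> I (\<lambda>i. u0 i + z * (us i - u0 i))"
    "spanning \<tau> \<eta> I (\<lambda>i. u0 i + z * (us i - u0 i)) p"
proof -
  define U where "U = (\<lambda>z i. u0 i + z * (us i - u0 i))"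
  define c where "c = (\<lambda>u. (\<Sum>i\<in>I. u i) - 2 * \<eta>)"
  \<comment> \<open>The nodes stay fixed along the whole line. As translates of \<open>u0\<close>
    they are incongruent even where \<open>us\<close> has collisions, and the translation makes
    their sum minus eta equal to the character at \<open>us\<close>, so that \<open>span\<close>
    represents their Lagrange basis.\<close>
  define v where "v = (\<lambda>i. u0 i + (\<eta> + c us - (\<Sum>i\<in>I. u0 i)) / of_nat (card I))"
  have "of_nat (card I) \<noteq> (0::complex)"
    using I by simp
  then have sum_v: "(\<Sum>i\<in>I. v i) - \<eta> = c us"
    by (simp add: v_def sum.distrib)
  have v: "v i - v j \<notin> period_lattice \<tau>" if "i \<in> I" "j \<in> I" "i \<noteq> j" for i j
    using u0 that by (simp add: v_def incongruent_on_def)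
  have "\<exists>\<xi>. \<forall>z. lagrange_theta \<tau> I v \<eta> k z = pair_sum p (pair_theta \<tau> \<eta> I us z) \<xi> I" if "k \<in> I" for k
    using span lagrange_theta_in_Theta_space[OF tau, of I k v \<eta>] that
    unfolding spanning_def sum_v c_def by simp
  then obtain \<xi> where \<xi>: "\<And>k z. k \<in> I \<Longrightarrow> lagrange_theta \<tau> I v \<eta> k z = pair_sum p (pair_theta \<tau> \<eta> I us z) (\<xi> k) I"
    by metis
  \<comment> \<open>Values at the nodes of the pair sums that represent the Lagrange basis at
    \<open>us\<close>; hence the identity at z = 1. Outside I the matrix is padded by the identity
    because its index type is all of 'n.\<close>
  define M where "M = (\<lambda>z. (\<chi> k l. if k \<in> I \<and> l \<in> I then pair_sum p (pair_theta \<tau> \<eta> I (U z) (v l)) (\<xi> k) I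
     else if k = l then 1 else 0) :: complex^'n^'n)"
  define F where "F = (\<lambda>z. det (M z))"
  define G where "G = (\<lambda>z. \<Prod>i\<in>I. \<Prod>j\<in>I-{i}. theta \<tau> (U z i - U z j))"
  \<comment> \<open>Three entire functions guard three properties: F that the pair sums can take any
    prescribed node values, G incongruence (known at 0), H the uniqueness criterion for the fixed
    nodes while the character moves. Each is nonzero at 0 or 1, hence at all points near 0 except
    possibly 0 itself.\<close>
  define H where "H = (\<lambda>z. theta \<tau> ((\<Sum>i\<in>I. v i) - c (U z)))"
  have U1: "U 1 = us" and U0: "U 0 = u0"
    by (auto simp: U_def)
  have U_hol: "(\<lambda>z. U z i) holomorphic_on UNIV" for i
    unfolding U_def by (intro holomorphic_intros)
  have "F holomorphic_on UNIV" "G holomorphic_on UNIV" "H holomorphic_on UNIV"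
  proof -
    have "(\<lambda>z. M z $ k $ l) holomorphic_on UNIV" for k l
      by (cases "k \<in> I \<and> l \<in> I") (auto simp: M_def intro!: holomorphic_intros U_hol)
    then show "F holomorphic_on UNIV"
      unfolding F_def det_def by (intro holomorphic_intros)
    show "G holomorphic_on UNIV"
      unfolding G_def by (intro holomorphic_intros holomorphic_theta[OF tau] U_hol)
    show "H holomorphic_on UNIV"
      unfolding H_def c_def by (intro holomorphic_intros holomorphic_theta[OF tau] U_hol)
  qed
  moreover have "F 1 \<noteq> 0"
  proof -
    have "lagrange_theta \<tau> I v \<eta> k (v l) = (if k = l then 1 else 0)" if "k \<in> I" "l \<in> I" for k l
      by (rule lagrange_theta_node[OF tau _ that eta v]) auto
    then have "M 1 = mat 1"
      unfolding M_def U1 mat_def using \<xi> by (auto simp: vec_eq_iff)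
    then show ?thesis
      by (simp add: F_def)
  qed
  moreover have "G 0 \<noteq> 0"
    using u0 unfolding G_def U0 incongruent_on_def by (auto simp: theta_eq_0_iff[OF tau])
  moreover have "H 1 \<noteq> 0"
    using eta sum_v unfolding H_def U1 by (simp add: theta_eq_0_iff[OF tau] algebra_simps)
  moreover have "\<forall>\<^sub>F z in at 0. f z \<noteq> 0" if "f holomorphic_on UNIV" "f b \<noteq> 0" for f b
    using non_zero_neighbour_alt[OF that(1) open_UNIV connected_UNIV, of 0 b] that(2)
    by (auto elim: eventually_mono)
  ultimately have "\<forall>\<^sub>F z in at 0. F z \<noteq> 0" "\<forall>\<^sub>F z in at 0. G z \<noteq> 0" "\<forall>\<^sub>F z in at 0. H z \<noteq> 0"
    by blast+
  moreover have "\<forall>\<^sub>F z in at 0. z \<in> ball 0 e"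
    using e by (intro eventually_at_in_open') auto
  ultimately have "\<forall>\<^sub>F z in at 0. F z \<noteq> 0 \<and> G z \<noteq> 0 \<and> H z \<noteq> 0 \<and> z \<in> ball 0 e"
    by eventually_elim auto
  then obtain z where z: "F z \<noteq> 0" "G z \<noteq> 0" "H z \<noteq> 0" "norm z < e"
    using eventually_happens'[of "at (0::complex)"] by (auto simp: mem_ball_0)
  have "incongruent_on \<tau> I (U z)"
    using z(2) unfolding G_def incongruent_on_def by (auto simp: theta_eq_0_iff[OF tau])
  moreover have "spanning \<tau> \<eta> I (U z) p"
    unfolding spanning_def
  proof
    fix f
    assume "f \<in> Theta_space (card I) ((\<Sum>i\<in>I. U z i) - 2 * \<eta>) \<tau>"
    then have f: "f \<in> Theta_space (card I) (c (U z)) \<tau>"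
      by (simp add: c_def)
    define y where "y = (\<chi> l. if l \<in> I then f (v l) else 0)"
    obtain M' where M': "M' ** M z = mat 1"
      using z(1) unfolding F_def invertible_det_nz[symmetric] invertible_def by auto
    define r where "r = y v* M'"
    have ry: "r v* M z = y"
      using M' by (simp add: r_def vector_matrix_mul_assoc)
    let ?g = "\<lambda>k w. pair_sum p (pair_theta \<tau> \<eta> I (U z) w) (\<xi> k) I"
    have node: "f (v l) = (\<Sum>k\<in>I. r $ k * ?g k (v l))" if "l \<in> I" for l
    proof -
      have "f (v l) = (r v* M z) $ l"
        unfolding ry using that by (simp add: y_def)
      also have "\<dots> = (\<Sum>k\<in>UNIV. M z $ k $ l * r $ k)"
        by (simp add: vector_matrix_mult_def mult.commute)
      also have "\<dots> = (\<Sum>k\<in>I. M z $ k $ l * r $ k)"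
        using that by (intro sum.mono_neutral_right) (auto simp: M_def)
      finally show ?thesis
        using that by (simp add: M_def mult_ac)
    qed
    have "f w - (\<Sum>k\<in>I. r $ k * ?g k w) = 0" for w
    proof (rule Theta_space_unique[where f = "\<lambda>w. f w - (\<Sum>k\<in>I. r $ k * ?g k w)" and I = I and v = v and c = "c (U z)"])
      show "(\<lambda>w. f w - (\<Sum>k\<in>I. r $ k * ?g k w)) \<in> Theta_space (card I) (c (U z)) \<tau>"
        unfolding c_def using f
        by (intro Theta_space_diff Theta_space_sum Theta_space_cmult pair_sum_in_Theta_space) (auto simp: c_def)
      show "(\<Sum>i\<in>I. v i) - c (U z) \<notin> period_lattice \<tau>"
        using z(3) by (simp add: H_def theta_eq_0_iff[OF tau])
    qed (use tau v node in auto)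
    then have "f w = pair_sum p (pair_theta \<tau> \<eta> I (U z) w) (\<lambda>i. \<Sum>k\<in>I. r $ k *s \<xi> k i) I" for w
      by (simp add: pair_sum_linear)
    then show "\<exists>\<xi>. \<forall>w. f w = pair_sum p (pair_theta \<tau> \<eta> I (U z) w) \<xi> I"
      by blast
  qed
  ultimately show ?thesis
    using that z(4) unfolding U_def by blast
qed

lemma exp_two_pi_eta: "exp (2 * of_real pi * \<i> * \<eta>) \<noteq> 1"
proof
  assume "exp (2 * of_real pi * \<i> * \<eta>) = 1"
  then obtain k where "\<eta> = of_int k"
    by (rule exp_two_pi_eq_1)
  then show False
    using eta period_latticeI[of \<eta> k 0] by simp
qed

text \<open>
  Two collisions are available, \<open>u N = u a\<close> and \<open>u N = u a + \<tau>\<close>; they merge \<open>p N\<close> into \<open>p a\<close> with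
  the distinct weights \<open>1\<close> and \<open>exp (2\<pi>i\<eta>)\<close>, and at least one of them preserves the rank.
\<close>

lemma merge_direction:
  assumes "tri pa pb pc \<noteq> 0"
  obtains l t where "l \<in> period_lattice \<tau>" "tri (pa + t *s pN) pb pc \<noteq> 0"
    "\<And>x ua. theta \<tau> (x - (ua + l) + \<eta>) * theta \<tau> (x - ua) = t * (theta \<tau> (x - ua + \<eta>) * theta \<tau> (x - (ua + l)))"
proof (cases "tri (pa + 1 *s pN) pb pc = 0")
  case False
  show ?thesis
    by (rule that[of 0 1]) (use False in auto)
next
  case True
  define t where "t = exp (2 * of_real pi * \<i> * \<eta>)"
  \<comment> \<open>The determinant is affine in the weight and nonzero at weight 0, so at most one
    weight is bad; here the weight 1 already is, and t differs from 1.\<close>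
  have "tri (pa + t *s pN) pb pc \<noteq> 0"
  proof
    assume "tri (pa + t *s pN) pb pc = 0"
    then have "tri pa pb pc + t * tri pN pb pc = 0" "tri pa pb pc + tri pN pb pc = 0"
      using True by (simp_all add: tri_linear)
    then have "(t - 1) * tri pN pb pc = 0"
      by algebra
    then show False
      using exp_two_pi_eta assms \<open>tri pa pb pc + tri pN pb pc = 0\<close> by (auto simp: t_def)
  qed
  moreover have "theta \<tau> (x - (ua + \<tau>) + \<eta>) * theta \<tau> (x - ua) = t * (theta \<tau> (x - ua + \<eta>) * theta \<tau> (x - (ua + \<tau>)))" for x ua
  proof -
    define y where "y = x - (ua + \<tau>)"
    have y: "x - ua = y + \<tau>" "x - ua + \<eta> = (y + \<eta>) + \<tau>"
      by (simp_all add: y_def)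
    have E: "exp (- 2 * of_real pi * \<i> * y) = t * exp (- 2 * of_real pi * \<i> * (y + \<eta>))"
      unfolding t_def exp_add[symmetric] by (rule arg_cong[of _ _ exp]) (simp add: algebra_simps)
    have "theta \<tau> (x - ua) = - exp (- 2 * of_real pi * \<i> * y) * theta \<tau> y"
      unfolding y(1) by (rule theta_add_tau[OF tau])
    moreover have "theta \<tau> (x - ua + \<eta>) = - exp (- 2 * of_real pi * \<i> * (y + \<eta>)) * theta \<tau> (y + \<eta>)"
      unfolding y(2) by (rule theta_add_tau[OF tau])
    ultimately show ?thesis
      unfolding y_def[symmetric] E by (simp only: mult_minus_left mult_minus_right mult_ac)
  qed
  moreover have "\<tau> \<in> period_lattice \<tau>"
    by (rule period_latticeI[of _ 0 1]) simp
  ultimately show ?thesis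
    by (intro that[of \<tau> t]) auto
qed

text \<open>A point N outside a basis triple is merged into a member of the triple, so the triple
  survives as the anchor of the induction. The collision is then perturbed away, because the next
  merge needs incongruent points.\<close>

lemma spanning_exists:
  fixes I :: "'n::finite set" and u0 :: "'n \<Rightarrow> complex"
  assumes u0: "incongruent_on \<tau> UNIV u0" and p: "\<And>i. i \<in> I \<Longrightarrow> p i \<noteq> 0"
    and abc: "a \<in> I" "b \<in> I" "c \<in> I" "tri (p a) (p b) (p c) \<noteq> 0"
  shows "\<exists>u. incongruent_on \<tau> I u \<and> spanning \<tau> \<eta> I u p"
  using finite[of I] p abc
proof (induction I arbitrary: p a b c rule: finite_psubset_induct)
  case (psubset I)
  note abc = psubset.prems(2-5)
  have u0': "incongruent_on \<tau> I u0"
    using u0 by (simp add: incongruent_on_def)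
  show ?case
  proof (cases "I = {a, b, c}")
    case True
    have "a \<noteq> b" "a \<noteq> c" "b \<noteq> c"
      using abc(4) by auto
    then show ?thesis
      using spanning_three[of a b c p u0] abc(4) u0' True by auto
  next
    case False
    then obtain N where N: "N \<in> I" "N \<noteq> a" "N \<noteq> b" "N \<noteq> c"
      using abc by auto
    \<comment> \<open>Since p N is nonzero, Cramer's rule finds two members of the triple
      independent of p N. A cyclic renaming calls them c' and a', so p c' can serve as the auxiliary
      vector x of \<open>spanning_merge\<close>.\<close>
    obtain a' b' c' where abc': "a' \<in> I - {N}" "b' \<in> I - {N}" "c' \<in> I - {N}"
      "tri (p a') (p b') (p c') \<noteq> 0" "tri (p c') (p a') (p N) \<noteq> 0"
    proof -
      have "tri (p N) (p b) (p c) \<noteq> 0 \<or> tri (p N) (p c) (p a) \<noteq> 0 \<or> tri (p N) (p a) (p b) \<noteq> 0"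
        using tri_cramer abc(4) psubset.prems(1)[OF N(1)] by blast
      then show ?thesis
        using that[of a b c] that[of b c a] that[of c a b] abc N
        by (metis (no_types, lifting) Diff_iff empty_iff insert_iff tri_cyclic)
    qed
    obtain l t where l: "l \<in> period_lattice \<tau>" and t: "tri (p a' + t *s p N) (p b') (p c') \<noteq> 0"
      and lt: "\<And>x ua. theta \<tau> (x - (ua + l) + \<eta>) * theta \<tau> (x - ua) = t * (theta \<tau> (x - ua + \<eta>) * theta \<tau> (x - (ua + l)))"
      using merge_direction[OF abc'(4)] by metis
    define p' where "p' = p(a' := p a' + t *s p N)"
    have ne: "b' \<noteq> a'" "c' \<noteq> a'"
      using abc'(4) by auto
    have "\<exists>u. incongruent_on \<tau> (I - {N}) u \<and> spanning \<tau> \<eta> (I - {N}) u p'"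
    proof (rule psubset.IH)
      show "I - {N} \<subset> I"
        using N by auto
      show "p' i \<noteq> 0" if "i \<in> I - {N}" for i
        using that psubset.prems(1)[of i] tri_nonzero_imp_nonzero(1)[OF t] by (auto simp: p'_def)
      show "tri (p' a') (p' b') (p' c') \<noteq> 0"
        using t ne by (simp add: p'_def)
    qed (use abc' in auto)
    then obtain u where u: "incongruent_on \<tau> (I - {N}) u" "spanning \<tau> \<eta> (I - {N}) u p'"
      by auto
    define us where "us = u(N := u a' + l)"
    have us: "us i = u i" if "i \<in> I - {N}" for i
      using that by (simp add: us_def)
    have "spanning \<tau> \<eta> I us p"
    proof (rule spanning_merge[where a = a' and N = N and t = t and x = "p c'"])
      show "incongruent_on \<tau> (I - {N}) us"
        using u(1) us by (simp add: incongruent_on_def)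
      show "spanning \<tau> \<eta> (I - {N}) us (p(a' := p a' + t *s p N))"
        using u(2) spanning_cong[of "I - {N}" us u] us by (simp add: p'_def)
      show "us N - us a' \<in> period_lattice \<tau>"
        using l abc'(1) by (simp add: us_def)
      show "theta \<tau> (x - us N + \<eta>) * theta \<tau> (x - us a') = t * (theta \<tau> (x - us a' + \<eta>) * theta \<tau> (x - us N))" for x
        using lt[of x "u a'"] abc'(1) by (simp add: us_def)
    qed (use abc' N in auto)
    then show ?thesis
      using spanning_perturb[of I us p u0 1] u0' N(1) by (metis empty_iff zero_less_one)
  qed
qed

end

section \<open>Constancy of the residues\<close>

lemma upd_nth [simp]: "upd u i z $ j = (if j = i then z else u $ j)"
  by (simp add: upd_def)

lemma upd_same [simp]: "upd u i (u $ i) = u"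
  by (simp add: vec_eq_iff)

lemma upd_upd [simp]: "upd (upd u i z) i z' = upd u i z'"
  by (simp add: vec_eq_iff)

lemma continuous_on_upd [continuous_intros]:
  "continuous_on A f \<Longrightarrow> continuous_on A (\<lambda>z. upd u i (f z))"
  unfolding upd_def
proof (rule continuous_on_vec_lambda)
  show "continuous_on A f \<Longrightarrow> continuous_on A (\<lambda>z. if j = i then f z else u $ j)" for j
    by (cases "j = i") auto
qed

lemma open_upd:
  assumes "open U" "u \<in> U"
  obtains r where "r > 0" "\<And>z. z \<in> ball (u $ i) r \<Longrightarrow> upd u i z \<in> U"
proof -
  have "open ((\<lambda>z. upd u i z) -` U)"
    by (intro open_vimage assms continuous_intros)
  moreover have "u $ i \<in> (\<lambda>z. upd u i z) -` U"
    using assms(2) by simp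
  ultimately obtain r where "r > 0" "ball (u $ i) r \<subseteq> (\<lambda>z. upd u i z) -` U"
    by (rule openE)
  then show ?thesis
    by (intro that[of r]) auto
qed

lemma holomorphic_upd_nth [holomorphic_intros]: "(\<lambda>z. upd u i z $ m) holomorphic_on A"
  by (cases "m = i") auto

text \<open>In a polydisc one changes one coordinate after the other.\<close>

lemma constant_if_partials_zero:
  fixes f :: "complex^'n \<Rightarrow> complex"
  assumes U: "open U" "connected U"
    and 0: "\<And>u i. u \<in> U \<Longrightarrow> ((\<lambda>z. f (upd u i z)) has_field_derivative 0) (at (u $ i))"
    and uv: "u \<in> U" "v \<in> U"
  shows "f u = f v"
proof (rule connected_local_const[OF U(2) uv], intro ballI)
  fix a
  assume a: "a \<in> U"
  then obtain e where e: "e > 0" "ball a e \<subseteq> U"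
    using U(1) openE by blast
  define d where "d = e / (2 * real CARD('n))"
  have d: "d > 0"
    using e by (simp add: d_def)
  have box: "w \<in> U" if "\<And>i. norm (w $ i - a $ i) < d" for w
  proof -
    have "norm (w - a) \<le> (\<Sum>i\<in>UNIV. norm ((w - a) $ i))"
      unfolding norm_vec_def by (rule L2_set_le_sum) simp
    also have "\<dots> \<le> (\<Sum>i\<in>(UNIV::'n set). d)"
      using that by (intro sum_mono) (simp add: less_imp_le)
    also have "\<dots> < e"
      using e by (simp add: d_def)
    finally show ?thesis
      using e by (auto simp: dist_norm norm_minus_commute)
  qed
  have "f a = f b" if b: "\<And>i. norm (b $ i - a $ i) < d" for b
  proof -
    define w where "w = (\<lambda>S. \<chi> j. if j \<in> S then b $ j else a $ j)"
    have "f (w S) = f a" for S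
    proof (induction S rule: infinite_finite_induct)
      case (insert i S)
      have eq: "w (insert i S) = upd (w S) i (b $ i)"
        by (simp add: w_def vec_eq_iff)
      have "\<exists>c. \<forall>z\<in>ball (a $ i) d. f (upd (w S) i z) = c"
      proof (rule has_field_derivative_zero_constant)
        fix z
        assume z: "z \<in> ball (a $ i) d"
        have "norm (upd (w S) i z $ j - a $ j) < d" for j
          using z b d by (auto simp: w_def dist_norm norm_minus_commute)
        then have "upd (w S) i z \<in> U"
          by (rule box)
        from 0[OF this, of i] show "((\<lambda>z. f (upd (w S) i z)) has_field_derivative 0) (at z within ball (a $ i) d)"
          by (simp add: has_field_derivative_at_within)
      qed auto
      moreover have "w S $ i = a $ i"
        using insert.hyps by (simp add: w_def)
      moreover have "a $ i \<in> ball (a $ i) d" "b $ i \<in> ball (a $ i) d"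
        using d b by (auto simp: dist_norm norm_minus_commute)
      ultimately have "f (upd (w S) i (b $ i)) = f (upd (w S) i (w S $ i))"
        by metis
      then show ?case
        using insert.IH by (simp add: eq)
    qed (auto simp: w_def)
    from this[of UNIV] show ?thesis
      by (simp add: w_def)
  qed
  moreover have "norm (b $ i - a $ i) < d" if "dist b a < d" for b i
    using that Finite_Cartesian_Product.norm_nth_le[of "b - a" i] by (simp add: dist_norm)
  ultimately show "\<forall>\<^sub>F b in at a within U. f a = f b"
    using d by (auto simp: eventually_at)
qed

text \<open>Up to the constant 1 / theta'(0), the residue at z = u_j of psi divided by the product
  of all theta(z - u_m), that is, of K_zeta.\<close>

definition residue_coeff :: "complex \<Rightarrow> (complex \<Rightarrow> complex^'n \<Rightarrow> complex) \<Rightarrow> 'n \<Rightarrow> complex^'n \<Rightarrow> complex" where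
  "residue_coeff \<tau> \<psi> j u = \<psi> (u $ j) u / (\<Prod>m\<in>-{j}. theta \<tau> (u $ j - u $ m))"

definition theta_basis :: "complex \<Rightarrow> complex \<Rightarrow> 'n \<Rightarrow> complex \<Rightarrow> complex^'n \<Rightarrow> complex" where
  "theta_basis \<tau> \<eta> j z u = theta \<tau> (z - u $ j + \<eta>) / theta \<tau> \<eta> * (\<Prod>m\<in>-{j}. theta \<tau> (z - u $ m))"

text \<open>Kronecker's elliptic function up to the constant theta'(0); it is the rho of the
  overview.\<close>

definition kronecker_ratio :: "complex \<Rightarrow> complex \<Rightarrow> complex \<Rightarrow> complex" where
  "kronecker_ratio \<tau> \<eta> z = theta \<tau> (z + \<eta>) / (theta \<tau> \<eta> * theta \<tau> z)"

context
  fixes \<tau> \<eta> :: complex and D :: "(complex \<times> (complex^'n)) set"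
  assumes tau: "Im \<tau> > 0" and eta: "\<eta> \<notin> period_lattice \<tau>"
    and D: "open D" "connected D" "D \<subseteq> admissible \<tau>"
begin

lemma open_snd_D: "open (snd ` D)" and connected_snd_D: "connected (snd ` D)"
  using open_image_snd[OF D(1)] connected_continuous_image[OF continuous_on_snd[OF continuous_on_id] D(2)] by auto

lemma incongruent_coordinates:
  assumes "u \<in> snd ` D" "i \<noteq> j"
  shows "u $ i - u $ j \<notin> period_lattice \<tau>"
  using assms D(3) by (force simp: admissible_def)

lemma theta_eta_nonzero: "theta \<tau> \<eta> \<noteq> 0"
  using eta by (simp add: theta_eq_0_iff[OF tau])

lemma theta_coordinates_nonzero:
  assumes "u \<in> snd ` D" "i \<noteq> j"
  shows "theta \<tau> (u $ i - u $ j) \<noteq> 0"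
  using incongruent_coordinates[OF assms] by (simp add: theta_eq_0_iff[OF tau])

lemma prod_coordinates_nonzero:
  assumes "u \<in> snd ` D"
  shows "(\<Prod>m\<in>-{j}. theta \<tau> (u $ j - u $ m)) \<noteq> 0"
  using theta_coordinates_nonzero[OF assms] by (subst prod_zero_iff) auto

lemma theta_solution_expansion:
  assumes \<psi>: "theta_solution \<tau> \<eta> (snd ` D) \<psi>" and u: "u \<in> snd ` D"
  shows "\<psi> z u = (\<Sum>j\<in>UNIV. residue_coeff \<tau> \<psi> j u * theta_basis \<tau> \<eta> j z u)"
proof -
  have "\<psi> z u = (\<Sum>k\<in>UNIV. \<psi> (u $ k) u * lagrange_theta \<tau> UNIV (\<lambda>i. u $ i) \<eta> k z)"
    using \<psi> u incongruent_coordinates[OF u]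
    by (intro lagrange_theta_interpolation[OF tau, where f = "\<lambda>z. \<psi> z u"] eta) (auto simp: theta_solution_def)
  then show ?thesis
    by (simp add: residue_coeff_def theta_basis_def lagrange_theta_def Compl_eq_Diff_UNIV mult.commute[of "theta \<tau> \<eta>"])
qed

lemma theta_basis_node:
  assumes u: "u \<in> snd ` D"
  shows "theta_basis \<tau> \<eta> j (u $ k) u = (if j = k then (\<Prod>m\<in>-{k}. theta \<tau> (u $ k - u $ m)) else 0)"
proof (cases "j = k")
  case False
  then have "(\<Prod>m\<in>-{j}. theta \<tau> (u $ k - u $ m)) = 0"
    using theta_0[OF tau] by (intro prod_zero) (auto intro!: bexI[of _ k])
  then show ?thesis
    using False by (simp add: theta_basis_def)
qed (simp add: theta_basis_def theta_eta_nonzero)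

lemma eventually_theta_nonzero: "\<forall>\<^sub>F z in at w. theta \<tau> (z + k) \<noteq> 0"
proof -
  have "(\<lambda>z. theta \<tau> (z + k)) holomorphic_on UNIV"
    by (intro holomorphic_theta[OF tau] holomorphic_intros)
  moreover have "theta \<tau> ((\<eta> - k) + k) \<noteq> 0"
    using theta_eta_nonzero by simp
  ultimately show ?thesis
    using non_zero_neighbour_alt[of "\<lambda>z. theta \<tau> (z + k)" UNIV w "\<eta> - k"] by (auto elim: eventually_mono)
qed

text \<open>
  In the direction \<open>u\<^sub>j\<close> itself the coefficient is read off the equation for \<open>K\<^bsub>u\<^sub>j\<^esub>\<close>; this avoids
  differentiating \<open>\<psi>(u\<^sub>j, u)\<close> along the diagonal.
\<close>

lemma residue_coeff_differentiable:
  assumes \<psi>: "theta_solution \<tau> \<eta> (snd ` D) \<psi>" and K: "potential_eqs \<tau> \<eta> D K \<psi>" and u: "u \<in> snd ` D"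
  shows "(\<lambda>z. residue_coeff \<tau> \<psi> j (upd u i z)) field_differentiable at (u $ i)"
proof (cases "i = j")
  case False
  have "(\<lambda>z. \<psi> (u $ j) (upd u i z)) field_differentiable at (u $ i)"
    using \<psi> u unfolding theta_solution_def analytic_pair_def by auto
  moreover have "(\<lambda>z. \<Prod>m\<in>-{j}. theta \<tau> (u $ j - upd u i z $ m)) holomorphic_on UNIV"
    by (intro holomorphic_intros holomorphic_theta[OF tau])
  then have "(\<lambda>z. \<Prod>m\<in>-{j}. theta \<tau> (u $ j - upd u i z $ m)) field_differentiable at (u $ i)"
    by (simp add: holomorphic_on_def)
  moreover have "(\<Prod>m\<in>-{j}. theta \<tau> (u $ j - upd u i (u $ i) $ m)) \<noteq> 0"
    using prod_coordinates_nonzero[OF u] by simp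
  ultimately have "(\<lambda>z. \<psi> (u $ j) (upd u i z) / (\<Prod>m\<in>-{j}. theta \<tau> (u $ j - upd u i z $ m))) field_differentiable at (u $ i)"
    by (rule field_differentiable_divide)
  then show ?thesis
    using False by (simp add: residue_coeff_def)
next
  case True
  \<comment> \<open>The fibre of D over u is open, so zeta can be moved off the zeros of theta(zeta
    - u_j + eta). The equation for K_(u_j) can then be solved for the coefficient, and the
    derivative of a holomorphic function is again holomorphic.\<close>
  obtain \<zeta>0 where "(\<zeta>0, u) \<in> D"
    using u by auto
  moreover have "open ((\<lambda>z. (z, u)) -` D)"
    by (intro open_vimage D continuous_intros)
  ultimately have "\<forall>\<^sub>F z in at \<zeta>0. z \<in> (\<lambda>z. (z, u)) -` D"
    by (intro eventually_at_in_open') auto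
  moreover have "\<forall>\<^sub>F z in at \<zeta>0. theta \<tau> (z + (\<eta> - u $ j)) \<noteq> 0"
    by (rule eventually_theta_nonzero)
  ultimately have "\<forall>\<^sub>F z in at \<zeta>0. z \<in> (\<lambda>z. (z, u)) -` D \<and> theta \<tau> (z + (\<eta> - u $ j)) \<noteq> 0"
    by eventually_elim auto
  then obtain \<zeta> where \<zeta>: "(\<zeta>, u) \<in> D" "theta \<tau> (\<zeta> - u $ j + \<eta>) \<noteq> 0"
    using eventually_happens'[of "at \<zeta>0"] by (auto simp: algebra_simps)
  have "open ((\<lambda>z. (\<zeta>, upd u j z)) -` D)"
    by (intro open_vimage D continuous_intros)
  moreover have "open {z. theta \<tau> (\<zeta> - z + \<eta>) \<noteq> 0}"
    by (intro open_Collect_neq continuous_on_theta[OF tau] continuous_intros)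
  ultimately have "open (((\<lambda>z. (\<zeta>, upd u j z)) -` D) \<inter> {z. theta \<tau> (\<zeta> - z + \<eta>) \<noteq> 0})" (is "open ?S")
    by (rule open_Int)
  moreover have "u $ j \<in> ?S"
    using \<zeta> by simp
  moreover define k where "k = (\<lambda>z. K \<zeta> (upd u j z))"
  have "k field_differentiable at z" if "z \<in> ?S" for z
  proof -
    have "(\<zeta>, upd u j z) \<in> D"
      using that by simp
    then have "(\<lambda>z'. K \<zeta> (upd (upd u j z) j z')) field_differentiable at (upd u j z $ j)"
      using K unfolding potential_eqs_def analytic_pair_def by fast
    then show ?thesis
      by (simp add: k_def)
  qed
  then have "k holomorphic_on ?S"
    by (auto simp: holomorphic_on_def intro: field_differentiable_at_within)
  then have dk: "deriv k holomorphic_on ?S"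
    using calculation(1) by (rule holomorphic_deriv)
  have "(\<lambda>z. - deriv k z * (theta \<tau> \<eta> * theta \<tau> (\<zeta> - z)) / theta \<tau> (\<zeta> - z + \<eta>)) holomorphic_on ?S"
    by (intro dk holomorphic_on_divide holomorphic_on_mult holomorphic_on_minus holomorphic_on_add holomorphic_on_diff
        holomorphic_on_const holomorphic_on_ident holomorphic_theta[OF tau]) auto
  moreover have "- deriv k z * (theta \<tau> \<eta> * theta \<tau> (\<zeta> - z)) / theta \<tau> (\<zeta> - z + \<eta>) = residue_coeff \<tau> \<psi> j (upd u j z)" if "z \<in> ?S" for z
  proof -
    let ?u = "upd u j z"
    have zD: "(\<zeta>, ?u) \<in> D"
      using that by simp
    then have "pd (K \<zeta>) j ?u = - (1 / (\<Prod>m\<in>-{j}. theta \<tau> (?u $ j - ?u $ m)))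
        * (theta \<tau> (\<zeta> - ?u $ j + \<eta>) / (theta \<tau> \<eta> * theta \<tau> (\<zeta> - ?u $ j))) * \<psi> (?u $ j) ?u"
      using K unfolding potential_eqs_def by fast
    moreover have "pd (K \<zeta>) j ?u = deriv k z"
      by (simp add: pd_def k_def)
    moreover have "theta \<tau> (\<zeta> - z) \<noteq> 0"
    proof -
      have "\<zeta> - ?u $ j \<notin> period_lattice \<tau>"
        using zD D(3) unfolding admissible_def by blast
      then show ?thesis
        by (simp add: theta_eq_0_iff[OF tau])
    qed
    ultimately show ?thesis
      using that theta_eta_nonzero by (simp add: residue_coeff_def)
  qed
  ultimately have "(\<lambda>z. residue_coeff \<tau> \<psi> j (upd u j z)) holomorphic_on ?S"
    by (blast intro: holomorphic_transform)
  then show ?thesis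
    using \<open>open ?S\<close> \<open>u $ j \<in> ?S\<close> True by (auto intro: holomorphic_on_imp_differentiable_at)
qed

text \<open>Exactly one factor contains u_i: theta(z - u_i + eta) if j = i, and theta(z - u_i)
  otherwise. The derivative is minus its logarithmic derivative times the whole product.\<close>

lemma theta_basis_derivative:
  assumes "theta \<tau> (z - u $ i) \<noteq> 0" "theta \<tau> (z - u $ i + \<eta>) \<noteq> 0"
  shows "((\<lambda>w. theta_basis \<tau> \<eta> j z (upd u i w)) has_field_derivative
    - (if j = i then deriv (theta \<tau>) (z - u $ i + \<eta>) / theta \<tau> (z - u $ i + \<eta>)
       else deriv (theta \<tau>) (z - u $ i) / theta \<tau> (z - u $ i)) * theta_basis \<tau> \<eta> j z u) (at (u $ i))"
proof -
  have d: "((\<lambda>w. theta \<tau> (k - w)) has_field_derivative - deriv (theta \<tau>) (k - w)) (at w)" for k w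
  proof -
    have "((\<lambda>w. k - w) has_field_derivative -1) (at w)"
      by (auto intro!: derivative_eq_intros)
    from DERIV_chain2[OF _ this, of "theta \<tau>" "deriv (theta \<tau>) (k - w)"] show ?thesis
      using theta_has_field_derivative[OF tau] by simp
  qed
  show ?thesis
  proof (cases "j = i")
    case True
    define C where "C = (\<Prod>m\<in>-{i}. theta \<tau> (z - u $ m)) / theta \<tau> \<eta>"
    have "(\<lambda>w. theta_basis \<tau> \<eta> j z (upd u i w)) = (\<lambda>w. C * theta \<tau> ((z + \<eta>) - w))"
      using True by (auto simp: theta_basis_def C_def fun_eq_iff algebra_simps intro!: prod.cong)
    moreover have "((\<lambda>w. C * theta \<tau> ((z + \<eta>) - w)) has_field_derivative C * - deriv (theta \<tau>) ((z + \<eta>) - u $ i)) (at (u $ i))"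
      by (intro DERIV_cmult d)
    moreover have "(z + \<eta>) - u $ i = z - u $ i + \<eta>"
      by simp
    moreover have "theta_basis \<tau> \<eta> j z u = C * theta \<tau> (z - u $ i + \<eta>)"
      using True by (simp add: theta_basis_def C_def)
    ultimately show ?thesis
      using True assms(2) by (simp add: mult.commute)
  next
    case False
    define C where "C = theta \<tau> (z - u $ j + \<eta>) / theta \<tau> \<eta> * (\<Prod>m\<in>-{j}-{i}. theta \<tau> (z - u $ m))"
    have "theta_basis \<tau> \<eta> j z (upd u i w) = C * theta \<tau> (z - w)" for w
    proof -
      have "(\<Prod>m\<in>-{j}. theta \<tau> (z - upd u i w $ m)) = theta \<tau> (z - w) * (\<Prod>m\<in>-{j}-{i}. theta \<tau> (z - u $ m))"
        using False by (subst prod.remove[of _ i]) auto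
      then show ?thesis
        using False by (simp add: theta_basis_def C_def)
    qed
    from this this[of "u $ i"] show ?thesis
      using DERIV_cmult[OF d[of z "u $ i"], of C] False assms(1) by (simp add: mult.commute)
  qed
qed

text \<open>The system (L) says precisely that the coefficients of \<open>\<psi>\<close> in the theta basis are constant.\<close>

lemma residue_coeff_derivative:
  assumes \<psi>: "theta_solution \<tau> \<eta> (snd ` D) \<psi>" and K: "potential_eqs \<tau> \<eta> D K \<psi>" and u: "u \<in> snd ` D"
  shows "((\<lambda>z. residue_coeff \<tau> \<psi> k (upd u i z)) has_field_derivative 0) (at (u $ i))"
proof -
  define c where "c = (\<lambda>j. residue_coeff \<tau> \<psi> j u)"
  define c' where "c' = (\<lambda>j. deriv (\<lambda>z. residue_coeff \<tau> \<psi> j (upd u i z)) (u $ i))"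
  define E where "E = (\<lambda>j z. theta_basis \<tau> \<eta> j z u)"
  \<comment> \<open>\<open>g\<close> is what remains when the derivative of the basis expansion is
    compared with (L): all terms without \<open>c'\<close> cancel.\<close>
  define g where "g = (\<lambda>z. \<Sum>j\<in>UNIV. c' j * E j z)"
  have c': "((\<lambda>z. residue_coeff \<tau> \<psi> j (upd u i z)) has_field_derivative c' j) (at (u $ i))" for j
    using residue_coeff_differentiable[OF \<psi> K u] by (simp add: c'_def field_differentiable_derivI)
  have g0: "g z = 0" if z: "theta \<tau> (z + - u $ i) \<noteq> 0" "theta \<tau> (z + (\<eta> - u $ i)) \<noteq> 0" for z
  proof -
    have nz: "theta \<tau> (z - u $ i) \<noteq> 0" "theta \<tau> (z - u $ i + \<eta>) \<noteq> 0"
      using z by (simp_all add: algebra_simps)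
    define Z1 where "Z1 = deriv (theta \<tau>) (z - u $ i) / theta \<tau> (z - u $ i)"
    define Z2 where "Z2 = deriv (theta \<tau>) (z - u $ i + \<eta>) / theta \<tau> (z - u $ i + \<eta>)"
    have exp: "\<psi> z u = (\<Sum>j\<in>UNIV. c j * E j z)"
      using theta_solution_expansion[OF \<psi> u] by (simp add: c_def E_def)
    obtain r where r: "r > 0" "\<And>w. w \<in> ball (u $ i) r \<Longrightarrow> upd u i w \<in> snd ` D"
      using open_upd[OF open_snd_D u] by blast
    have "((\<lambda>w. \<Sum>j\<in>UNIV. residue_coeff \<tau> \<psi> j (upd u i w) * theta_basis \<tau> \<eta> j z (upd u i w)) has_field_derivative
        (\<Sum>j\<in>UNIV. c' j * E j z + - (if j = i then Z2 else Z1) * E j z * c j)) (at (u $ i))"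
    proof (rule DERIV_sum)
      show "((\<lambda>w. residue_coeff \<tau> \<psi> j (upd u i w) * theta_basis \<tau> \<eta> j z (upd u i w)) has_field_derivative
          c' j * E j z + - (if j = i then Z2 else Z1) * E j z * c j) (at (u $ i))" for j
        using DERIV_mult[OF c'[of j] theta_basis_derivative[OF nz, of j]]
        by (simp only: upd_same c_def E_def Z1_def Z2_def)
    qed
    then have "((\<lambda>w. \<psi> z (upd u i w)) has_field_derivative
        (\<Sum>j\<in>UNIV. c' j * E j z + - (if j = i then Z2 else Z1) * E j z * c j)) (at (u $ i))"
      by (rule has_field_derivative_transform_within[OF _ r(1)])
         (use r theta_solution_expansion[OF \<psi>] in \<open>auto simp: dist_commute\<close>)
    then have "pd (\<psi> z) i u = (\<Sum>j\<in>UNIV. c' j * E j z + - (if j = i then Z2 else Z1) * E j z * c j)"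
      unfolding pd_def by (rule DERIV_imp_deriv)
    also have "\<dots> = g z + (\<Sum>j\<in>UNIV. - (if j = i then Z2 else Z1) * E j z * c j)"
      unfolding g_def sum.distrib ..
    \<comment> \<open>Using Z1 in all terms reproduces psi; the correction at j = i is the remaining
      term of (L).\<close>
    also have "(\<Sum>j\<in>UNIV. - (if j = i then Z2 else Z1) * E j z * c j) =
        (\<Sum>j\<in>UNIV. - Z1 * (c j * E j z) + (if j = i then (Z1 - Z2) * (c i * E i z) else 0))"
      by (intro sum.cong) (auto simp: algebra_simps)
    also have "\<dots> = - Z1 * \<psi> z u + (Z1 - Z2) * (c i * E i z)"
      unfolding sum.distrib exp sum_distrib_left by simp
    finally have pd1: "pd (\<psi> z) i u = g z + (- Z1 * \<psi> z u + (Z1 - Z2) * (c i * E i z))" .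
    have sol: "solves_L \<tau> \<eta> (snd ` D) \<psi>"
      using \<psi> by (simp add: theta_solution_def)
    have lat: "z - u $ i \<notin> period_lattice \<tau>" "z - u $ i + \<eta> \<notin> period_lattice \<tau>"
      using nz by (simp_all add: theta_eq_0_iff[OF tau])
    have "pd (\<psi> z) i u = \<psi> (u $ i) u
         * ((\<Prod>m\<in>-{i}. theta \<tau> (z - u $ m)) / (\<Prod>m\<in>-{i}. theta \<tau> (u $ i - u $ m)))
         * (theta \<tau> (z - u $ i + \<eta>) / theta \<tau> \<eta>) * (Z1 - Z2) - Z1 * \<psi> z u"
      using sol[unfolded solves_L_def, rule_format, OF u lat] by (simp only: Z1_def Z2_def)
    also have "\<dots> = (Z1 - Z2) * (c i * E i z) - Z1 * \<psi> z u"
      by (simp add: c_def E_def residue_coeff_def theta_basis_def)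
    finally show ?thesis
      using pd1 by (simp add: algebra_simps)
  qed
  \<comment> \<open>For k = i the point u_k is among those excluded in \<open>g0\<close>, so the
    identity theorem is needed before evaluating there.\<close>
  have "g (u $ k) = 0"
  proof (rule ccontr)
    assume nz: "g (u $ k) \<noteq> 0"
    have "g holomorphic_on UNIV"
      unfolding g_def E_def theta_basis_def
      by (intro holomorphic_intros holomorphic_theta[OF tau]) (use theta_eta_nonzero in auto)
    then have "\<forall>\<^sub>F z in at (u $ k). g z \<noteq> 0 \<and> z \<in> UNIV"
      using nz by (intro non_zero_neighbour_alt[where \<beta> = "u $ k"]) auto
    moreover have "\<forall>\<^sub>F z in at (u $ k). theta \<tau> (z + - u $ i) \<noteq> 0" "\<forall>\<^sub>F z in at (u $ k). theta \<tau> (z + (\<eta> - u $ i)) \<noteq> 0"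
      by (rule eventually_theta_nonzero)+
    ultimately have "\<forall>\<^sub>F z in at (u $ k). False"
      by eventually_elim (use g0 in blast)
    then show False
      by simp
  qed
  moreover have "g (u $ k) = (\<Sum>j\<in>UNIV. if j = k then c' k * (\<Prod>m\<in>-{k}. theta \<tau> (u $ k - u $ m)) else 0)"
    unfolding g_def E_def by (intro sum.cong) (auto simp: theta_basis_node[OF u])
  ultimately have "c' k = 0"
    using prod_coordinates_nonzero[OF u] by simp
  then show ?thesis
    using c'[of k] by simp
qed

lemma residue_coeff_constant:
  assumes "theta_solution \<tau> \<eta> (snd ` D) \<psi>" "potential_eqs \<tau> \<eta> D K \<psi>" "u \<in> snd ` D" "v \<in> snd ` D"
  shows "residue_coeff \<tau> \<psi> k u = residue_coeff \<tau> \<psi> k v"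
  using constant_if_partials_zero[OF open_snd_D connected_snd_D residue_coeff_derivative[OF assms(1,2)] assms(3,4)] .

lemma potential_eqs_residue:
  assumes \<psi>: "theta_solution \<tau> \<eta> (snd ` D) \<psi>" and K: "potential_eqs \<tau> \<eta> D K \<psi>" and zu: "(z, u) \<in> D"
  shows "deriv (\<lambda>z. K z u) z = (\<Sum>j\<in>UNIV. residue_coeff \<tau> \<psi> j u * kronecker_ratio \<tau> \<eta> (z - u $ j))"
    and "pd (K z) i u = - residue_coeff \<tau> \<psi> i u * kronecker_ratio \<tau> \<eta> (z - u $ i)"
proof -
  have u: "u \<in> snd ` D"
    using zu by force
  have nz: "theta \<tau> (z - u $ m) \<noteq> 0" for m
    using zu D(3) unfolding theta_eq_0_iff[OF tau] admissible_def by blast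
  have "deriv (\<lambda>z. K z u) z = \<psi> z u / (\<Prod>m\<in>UNIV. theta \<tau> (z - u $ m))"
    using K zu unfolding potential_eqs_def by fast
  also have "\<dots> = (\<Sum>j\<in>UNIV. residue_coeff \<tau> \<psi> j u * kronecker_ratio \<tau> \<eta> (z - u $ j))"
    unfolding theta_solution_expansion[OF \<psi> u] sum_divide_distrib
  proof (rule sum.cong)
    fix j
    have "(\<Prod>m\<in>UNIV. theta \<tau> (z - u $ m)) = theta \<tau> (z - u $ j) * (\<Prod>m\<in>-{j}. theta \<tau> (z - u $ m))"
      by (subst prod.remove[of _ j]) (auto simp: Compl_eq_Diff_UNIV)
    moreover have "(\<Prod>m\<in>-{j}. theta \<tau> (z - u $ m)) \<noteq> 0"
      using nz by simp
    ultimately show "residue_coeff \<tau> \<psi> j u * theta_basis \<tau> \<eta> j z u / (\<Prod>m\<in>UNIV. theta \<tau> (z - u $ m)) =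
        residue_coeff \<tau> \<psi> j u * kronecker_ratio \<tau> \<eta> (z - u $ j)"
      using nz by (simp add: theta_basis_def kronecker_ratio_def)
  qed simp
  finally show "deriv (\<lambda>z. K z u) z = (\<Sum>j\<in>UNIV. residue_coeff \<tau> \<psi> j u * kronecker_ratio \<tau> \<eta> (z - u $ j))" .
  have "pd (K z) i u = - (1 / (\<Prod>m\<in>-{i}. theta \<tau> (u $ i - u $ m)))
        * (theta \<tau> (z - u $ i + \<eta>) / (theta \<tau> \<eta> * theta \<tau> (z - u $ i))) * \<psi> (u $ i) u"
    using K zu unfolding potential_eqs_def by fast
  then show "pd (K z) i u = - residue_coeff \<tau> \<psi> i u * kronecker_ratio \<tau> \<eta> (z - u $ i)"
    by (simp add: residue_coeff_def kronecker_ratio_def)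
qed

end

section \<open>The quasilinear system\<close>

lemma tri_axis:
  "tri x y z = x $ 1 * tri (axis 1 1) y z + x $ 2 * tri (axis 2 1) y z + x $ 3 * tri (axis 3 1) y z"
  by (simp add: tri_def Let_def axis_def)

text \<open>Rank below 3 yields a functional killing all p_j, by cases on the rank: the cross
  product of two independent p's (rank 2), that of an auxiliary x with a nonzero p (rank 1), or any
  functional (rank 0).\<close>

lemma linear_relation_if_tri_zero:
  fixes p :: "'i \<Rightarrow> complex^3"
  assumes "\<And>a b c. tri (p a) (p b) (p c) = 0"
  obtains k :: "complex^3" where "k \<noteq> 0" "\<And>j. k $ 1 * p j $ 1 + k $ 2 * p j $ 2 + k $ 3 * p j $ 3 = 0"
proof -
  define cr :: "complex^3 \<Rightarrow> complex^3 \<Rightarrow> complex^3" where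
    "cr = (\<lambda>y z. vector [tri (axis 1 1) y z, tri (axis 2 1) y z, tri (axis 3 1) y z])"
  have cr: "cr y z $ 1 * x $ 1 + cr y z $ 2 * x $ 2 + cr y z $ 3 * x $ 3 = tri x y z" for x y z
    unfolding tri_axis[of x] by (simp add: cr_def mult.commute)
  show ?thesis
  proof (cases "\<exists>a b. cr (p a) (p b) \<noteq> 0")
    case True
    then obtain a b where "cr (p a) (p b) \<noteq> 0"
      by blast
    then show ?thesis
      using assms by (intro that[of "cr (p a) (p b)"]) (simp_all add: cr)
  next
    case False
    show ?thesis
    proof (cases "\<exists>a. p a \<noteq> 0")
      case True
      then obtain a where a: "p a \<noteq> 0"
        by blast
      have "\<exists>x. cr x (p a) \<noteq> 0"
      proof (rule ccontr)
        assume "\<nexists>x. cr x (p a) \<noteq> 0"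
        then have *: "tri (axis l 1) x (p a) = 0" for x and l :: 3
          using cr[of x "p a" "axis l 1"] by simp
        have "p a $ 3 = 0" "p a $ 2 = 0" "p a $ 1 = 0"
          using *[of 1 "axis 2 1"] *[of 1 "axis 3 1"] *[of 2 "axis 3 1"] by (simp_all add: tri_def Let_def axis_def)
        then show False
          using a by (simp add: vec_eq_iff forall_3)
      qed
      then obtain x where x: "cr x (p a) \<noteq> 0"
        by blast
      have "tri (p j) x (p a) = 0" for j
        using cr[of "p a" "p j" x] False tri_cyclic[of x "p a" "p j"] by simp
      then show ?thesis
        using x by (intro that[of "cr x (p a)"]) (simp_all add: cr)
    next
      case False
      then show ?thesis
        by (intro that[of "axis 1 1"]) (auto simp: axis_eq_0_iff)
    qed
  qed
qed

text \<open>For each i the three terms form the determinant with rows X_i, the u_i-derivatives and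
  the zeta-derivatives, that is, X_i, -r_i p_i and the sum of all r_j p_j. The term j = i drops out
  because two rows are proportional.\<close>

lemma compatibility_sum:
  fixes p X :: "'n::finite \<Rightarrow> complex^3" and r :: "'n \<Rightarrow> complex"
  defines "S \<equiv> (\<lambda>l. \<Sum>j\<in>UNIV. p j $ l * r j)" and "g \<equiv> (\<lambda>l i. - (p i $ l) * r i)"
  shows "(\<Sum>i\<in>UNIV. (S 3 * g 2 i - S 2 * g 3 i) * X i $ 1) + (\<Sum>i\<in>UNIV. (S 1 * g 3 i - S 3 * g 1 i) * X i $ 2)
      + (\<Sum>i\<in>UNIV. (S 2 * g 1 i - S 1 * g 2 i) * X i $ 3) = - pair_sum p (\<lambda>i j. r i * r j) X UNIV"
proof -
  have "(S 3 * g 2 i - S 2 * g 3 i) * X i $ 1 + (S 1 * g 3 i - S 3 * g 1 i) * X i $ 2 + (S 2 * g 1 i - S 1 * g 2 i) * X i $ 3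
      = - (\<Sum>j\<in>UNIV-{i}. tri (X i) (p i) (p j) * (r i * r j))" for i
  proof -
    have "(S 3 * g 2 i - S 2 * g 3 i) * X i $ 1 + (S 1 * g 3 i - S 3 * g 1 i) * X i $ 2 + (S 2 * g 1 i - S 1 * g 2 i) * X i $ 3
        = - tri (X i) (p i) (vector [S 1, S 2, S 3]) * r i"
      by (simp add: tri_def Let_def g_def algebra_simps)
    also have "vector [S 1, S 2, S 3] = (\<Sum>j\<in>UNIV. r j *s p j)"
      by (simp add: vec_eq_iff forall_3 S_def mult.commute)
    also have "tri (X i) (p i) (\<Sum>j\<in>UNIV. r j *s p j) = (\<Sum>j\<in>UNIV. r j * tri (X i) (p i) (p j))"
      unfolding tri_cyclic[of "X i" "p i"] by (rule tri_sum_left)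
    also have "\<dots> = (\<Sum>j\<in>UNIV-{i}. r j * tri (X i) (p i) (p j))"
      by (intro sum.mono_neutral_right) auto
    finally show ?thesis
      by (simp add: sum_distrib_left mult_ac)
  qed
  then show ?thesis
    unfolding pair_sum_def sum.distrib[symmetric] sum_negf[symmetric] by simp
qed

text \<open>Row k is the condition at the k-th shifted node. The index l = 1, 2, 3 selects the
  derivatives in y, t, x, matching the order F, G, H of the components of p.\<close>

definition compat_coeff :: "complex \<Rightarrow> complex \<Rightarrow> ('n::finite \<Rightarrow> complex^3) \<Rightarrow> 3 \<Rightarrow> complex^'n \<Rightarrow> complex^'n^'n" where
  "compat_coeff \<tau> \<eta> p l u = (\<chi> k i. \<Sum>j\<in>UNIV-{i}. tri (axis l 1) (p i) (p j) *
     pair_theta \<tau> \<eta> UNIV (vec_nth u) (u $ k - \<eta> / of_nat CARD('n)) i j)"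

lemma pair_sum_compat_coeff:
  fixes p X :: "'n::finite \<Rightarrow> complex^3" and u :: "complex^'n"
  shows "pair_sum p (pair_theta \<tau> \<eta> UNIV (vec_nth u) (u $ k - \<eta> / of_nat CARD('n))) X UNIV =
    (\<Sum>i\<in>UNIV. compat_coeff \<tau> \<eta> p 1 u $ k $ i * X i $ 1) + (\<Sum>i\<in>UNIV. compat_coeff \<tau> \<eta> p 2 u $ k $ i * X i $ 2)
    + (\<Sum>i\<in>UNIV. compat_coeff \<tau> \<eta> p 3 u $ k $ i * X i $ 3)"
proof -
  let ?B = "pair_theta \<tau> \<eta> UNIV (vec_nth u) (u $ k - \<eta> / of_nat CARD('n))"
  have "(\<Sum>j\<in>UNIV-{i}. tri (X i) (p i) (p j) * ?B i j) =
      (\<Sum>j\<in>UNIV-{i}. tri (axis 1 1) (p i) (p j) * ?B i j) * X i $ 1 + (\<Sum>j\<in>UNIV-{i}. tri (axis 2 1) (p i) (p j) * ?B i j) * X i $ 2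
      + (\<Sum>j\<in>UNIV-{i}. tri (axis 3 1) (p i) (p j) * ?B i j) * X i $ 3" for i
    unfolding sum_distrib_right sum.distrib[symmetric]
    by (intro sum.cong refl, subst tri_axis) (simp add: algebra_simps)
  then show ?thesis
    unfolding pair_sum_def compat_coeff_def by (simp add: sum.distrib)
qed

context
  fixes \<tau> \<eta> :: complex and D :: "(complex \<times> (complex^'n)) set" and p :: "'n \<Rightarrow> complex^3"
  assumes tau: "Im \<tau> > 0" and eta: "\<eta> \<notin> period_lattice \<tau>"
    and D: "open D" "connected D" "D \<subseteq> admissible \<tau>"
begin

text \<open>The shifts add up to eta, so the sum of the nodes exceeds the character by eta, which is
  not a period.\<close>

lemma sum_shifted_coordinates:
  fixes u :: "complex^'n"
  shows "(\<Sum>k\<in>UNIV. u $ k - \<eta> / of_nat CARD('n)) - \<eta> = (\<Sum>k\<in>UNIV. u $ k) - 2 * \<eta>"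
  by (simp add: sum_subtractf)

text \<open>Both sides say that the theta function vanishes identically: the left by the identity
  theorem on the nonempty open fibre of D over u, the right by uniqueness at n incongruent
  nodes.\<close>

lemma pair_sum_zero_iff:
  assumes u: "u \<in> snd ` D"
  shows "(\<forall>z. (z, u) \<in> D \<longrightarrow> pair_sum p (pair_theta \<tau> \<eta> UNIV (vec_nth u) z) X UNIV = 0) \<longleftrightarrow>
    (\<forall>k. pair_sum p (pair_theta \<tau> \<eta> UNIV (vec_nth u) (u $ k - \<eta> / of_nat CARD('n))) X UNIV = 0)" (is "?L \<longleftrightarrow> ?R")
proof -
  define g where "g = (\<lambda>z. pair_sum p (pair_theta \<tau> \<eta> UNIV (vec_nth u) z) X UNIV)"
  have g: "g \<in> Theta_space CARD('n) ((\<Sum>k\<in>UNIV. u $ k) - 2 * \<eta>) \<tau>"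
    unfolding g_def by (rule pair_sum_in_Theta_space[OF tau eta]) auto
  have "g z = 0" if ?L for z
  proof (rule ccontr)
    assume nz: "g z \<noteq> 0"
    obtain z0 where z0: "(z0, u) \<in> D"
      using u by auto
    have "\<forall>\<^sub>F z in at z0. g z \<noteq> 0 \<and> z \<in> UNIV"
      using Theta_spaceD(1)[OF g] nz by (intro non_zero_neighbour_alt[where \<beta> = z]) auto
    moreover have "open ((\<lambda>z. (z, u)) -` D)"
      by (intro open_vimage D continuous_intros)
    then have "\<forall>\<^sub>F z in at z0. z \<in> (\<lambda>z. (z, u)) -` D"
      using z0 by (intro eventually_at_in_open') auto
    ultimately have "\<forall>\<^sub>F z in at z0. False"
      by eventually_elim (use that in \<open>auto simp: g_def\<close>)
    then show False
      by simp
  qed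
  moreover have "g z = 0" if ?R for z
  proof (rule Theta_space_unique[where f = g and I = UNIV and v = "\<lambda>k. u $ k - \<eta> / of_nat CARD('n)"
        and c = "(\<Sum>k\<in>UNIV. u $ k) - 2 * \<eta>"])
    show "(\<Sum>k\<in>UNIV. u $ k - \<eta> / of_nat CARD('n)) - ((\<Sum>k\<in>UNIV. u $ k) - 2 * \<eta>) \<notin> period_lattice \<tau>"
      using eta unfolding sum_shifted_coordinates[symmetric] by simp
  qed (use tau g that incongruent_coordinates[OF tau eta D u] in \<open>auto simp: g_def\<close>)
  ultimately show ?thesis
    unfolding g_def by blast
qed

lemma compatible_iff_quasilinear:
  assumes F: "theta_solution \<tau> \<eta> (snd ` D) \<phi>" "potential_eqs \<tau> \<eta> D F \<phi>"
    and G: "theta_solution \<tau> \<eta> (snd ` D) \<phi>1" "potential_eqs \<tau> \<eta> D G \<phi>1"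
    and H: "theta_solution \<tau> \<eta> (snd ` D) \<phi>2" "potential_eqs \<tau> \<eta> D H \<phi>2"
    and p: "\<And>j u. u \<in> snd ` D \<Longrightarrow> residue_coeff \<tau> \<phi> j u = p j $ 1"
       "\<And>j u. u \<in> snd ` D \<Longrightarrow> residue_coeff \<tau> \<phi>1 j u = p j $ 2"
       "\<And>j u. u \<in> snd ` D \<Longrightarrow> residue_coeff \<tau> \<phi>2 j u = p j $ 3"
    and w: "w q \<in> snd ` D"
  shows "compatible_at D F G H w q \<longleftrightarrow>
    quasilinear_at (compat_coeff \<tau> \<eta> p 1) (compat_coeff \<tau> \<eta> p 2) (compat_coeff \<tau> \<eta> p 3) w q"
proof -
  define u where "u = w q"
  define X :: "'n \<Rightarrow> complex^3" where "X = (\<lambda>i. vector [dvec w 2 q $ i, dvec w 3 q $ i, dvec w 1 q $ i])"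
  have u: "u \<in> snd ` D"
    using w by (simp add: u_def)
  have X: "dvec w 2 q $ i = X i $ 1" "dvec w 3 q $ i = X i $ 2" "dvec w 1 q $ i = X i $ 3" for i
    by (simp_all add: X_def)
  have "compatible_at D F G H w q \<longleftrightarrow> (\<forall>z. (z, u) \<in> D \<longrightarrow> pair_sum p (pair_theta \<tau> \<eta> UNIV (vec_nth u) z) X UNIV = 0)"
  proof -
    have "(let F\<zeta> = deriv (\<lambda>z. F z u) z; Fu = (\<lambda>i. pd (F z) i u);
          G\<zeta> = deriv (\<lambda>z. G z u) z; Gu = (\<lambda>i. pd (G z) i u);
          H\<zeta> = deriv (\<lambda>z. H z u) z; Hu = (\<lambda>i. pd (H z) i u);
          wx = dvec w 1 q; wy = dvec w 2 q; wt = dvec w 3 q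
      in (\<Sum>i\<in>UNIV. (H\<zeta> * Gu i - G\<zeta> * Hu i) * wy $ i)
         + (\<Sum>i\<in>UNIV. (F\<zeta> * Hu i - H\<zeta> * Fu i) * wt $ i)
         + (\<Sum>i\<in>UNIV. (G\<zeta> * Fu i - F\<zeta> * Gu i) * wx $ i) = 0) \<longleftrightarrow>
       pair_sum p (pair_theta \<tau> \<eta> UNIV (vec_nth u) z) X UNIV = 0" if z: "(z, u) \<in> D" for z
    proof -
      define r where "r = (\<lambda>i. kronecker_ratio \<tau> \<eta> (z - u $ i))"
      \<comment> \<open>The common denominator; it is nonzero on D, so clearing it does not change
        the condition.\<close>
      define C where "C = theta \<tau> \<eta> * theta \<tau> \<eta> * (\<Prod>m\<in>UNIV. theta \<tau> (z - u $ m))"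
      have nz: "theta \<tau> (z - u $ m) \<noteq> 0" for m
        using z D(3) unfolding theta_eq_0_iff[OF tau] admissible_def by blast
      have eta0: "theta \<tau> \<eta> \<noteq> 0"
        using eta by (simp add: theta_eq_0_iff[OF tau])
      have C: "C \<noteq> 0"
        using nz eta0 by (simp add: C_def)
      have B: "pair_theta \<tau> \<eta> UNIV (vec_nth u) z i j = r i * r j * C" if "i \<noteq> j" for i j
      proof -
        have "(\<Prod>m\<in>UNIV. theta \<tau> (z - u $ m)) = theta \<tau> (z - u $ i) * (theta \<tau> (z - u $ j) * (\<Prod>m\<in>UNIV-{i}-{j}. theta \<tau> (z - u $ m)))"
          using that by (subst prod.remove[of _ i], simp, simp, subst prod.remove[of _ j]) auto
        moreover have "UNIV - {i} - {j} = UNIV - {i, j}"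
          by auto
        ultimately show ?thesis
          using nz[of i] nz[of j] eta0 by (simp add: pair_theta_def C_def r_def kronecker_ratio_def)
      qed
      have "pair_sum p (pair_theta \<tau> \<eta> UNIV (vec_nth u) z) X UNIV = pair_sum p (\<lambda>i j. r i * r j * C) X UNIV"
        by (rule pair_sum_cong) (simp_all add: B)
      then have zero: "pair_sum p (pair_theta \<tau> \<eta> UNIV (vec_nth u) z) X UNIV = 0 \<longleftrightarrow> pair_sum p (\<lambda>i j. r i * r j) X UNIV = 0"
        unfolding pair_sum_cmult using C by simp
      note R = potential_eqs_residue[OF tau eta D]
      show ?thesis
        unfolding zero Let_def R(1)[OF F z] R(1)[OF G z] R(1)[OF H z] R(2)[OF F z] R(2)[OF G z] R(2)[OF H z]
          p[OF u] X r_def[symmetric]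
        using compatibility_sum[of p r X] by (simp only: r_def neg_equal_0_iff_equal)
    qed
    then show ?thesis
      unfolding compatible_at_def u_def[symmetric] by blast
  qed
  also have "\<dots> \<longleftrightarrow> (\<forall>k. pair_sum p (pair_theta \<tau> \<eta> UNIV (vec_nth u) (u $ k - \<eta> / of_nat CARD('n))) X UNIV = 0)"
    by (rule pair_sum_zero_iff[OF u])
  also have "\<dots> \<longleftrightarrow> quasilinear_at (compat_coeff \<tau> \<eta> p 1) (compat_coeff \<tau> \<eta> p 2) (compat_coeff \<tau> \<eta> p 3) w q"
    unfolding quasilinear_at_def u_def[symmetric] X pair_sum_compat_coeff ..
  finally show ?thesis .
qed

section \<open>Analytic coefficients and independence on a dense open set\<close>

lemma continuous_on_pair_theta:
  fixes A :: "(complex^'n) set"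
  shows "continuous_on A (\<lambda>u. pair_theta \<tau> \<eta> UNIV (vec_nth u) (u $ k - \<eta> / of_nat CARD('n)) i j)"
  unfolding pair_theta_def by (intro continuous_intros continuous_on_theta[OF tau])

lemma analytic_compat_coeff: "analytic_vec (\<lambda>u. compat_coeff \<tau> \<eta> p l u $ k $ i) (A :: (complex^'n) set)"
proof -
  have "(\<lambda>z. compat_coeff \<tau> \<eta> p l (upd u m z) $ k $ i) holomorphic_on UNIV" for u m
    unfolding compat_coeff_def pair_theta_def vec_lambda_beta
    by (intro holomorphic_intros holomorphic_theta[OF tau]) 
  moreover have "continuous_on A (\<lambda>u. compat_coeff \<tau> \<eta> p l u $ k $ i)"
    unfolding compat_coeff_def vec_lambda_beta by (intro continuous_intros continuous_on_pair_theta)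
  ultimately show ?thesis
    unfolding analytic_vec_def by (simp add: holomorphic_on_def)
qed

text \<open>Each entry is a linear combination of the coefficients in row k of (a | b | c). A
  relation l between the rows is thus a kernel vector of this matrix, and invertibility forces l =
  0.\<close>

definition span_matrix :: "('n \<Rightarrow> 'n \<Rightarrow> complex^3) \<Rightarrow> complex^'n \<Rightarrow> complex^'n^'n" where
  "span_matrix \<xi> u = (\<chi> m k. pair_sum p (pair_theta \<tau> \<eta> UNIV (vec_nth u) (u $ k - \<eta> / of_nat CARD('n))) (\<xi> m) UNIV)"

text \<open>The family \<open>\<xi>\<close> may change with u; a union over all families gives
  openness without choosing it continuously.\<close>

definition generic_points :: "(complex^'n) set" where
  "generic_points = (\<Union>\<xi>. {u. det (span_matrix \<xi> u) \<noteq> 0})"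

lemma open_generic_points: "open generic_points"
proof -
  have "continuous_on UNIV (\<lambda>u. det (span_matrix \<xi> u))" for \<xi>
    unfolding det_def span_matrix_def pair_sum_def vec_lambda_beta
    by (intro continuous_intros continuous_on_pair_theta)
  then show ?thesis
    unfolding generic_points_def by (intro open_UN ballI open_Collect_neq continuous_intros) auto
qed

lemma independent_generic_points:
  assumes "V \<subseteq> generic_points"
  shows "independent_equations V (compat_coeff \<tau> \<eta> p 1) (compat_coeff \<tau> \<eta> p 2) (compat_coeff \<tau> \<eta> p 3)"
  unfolding independent_equations_def
proof (intro ballI allI impI)
  fix u and l :: "complex^'n"
  assume "u \<in> V"
  then obtain \<xi> where "det (span_matrix \<xi> u) \<noteq> 0"
    using assms by (auto simp: generic_points_def)
  then obtain M' where M': "M' ** span_matrix \<xi> u = mat 1"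
    unfolding invertible_det_nz[symmetric] invertible_def by auto
  assume "l v* compat_coeff \<tau> \<eta> p 1 u = 0 \<and> l v* compat_coeff \<tau> \<eta> p 2 u = 0 \<and> l v* compat_coeff \<tau> \<eta> p 3 u = 0"
  then have 0: "(\<Sum>k\<in>UNIV. compat_coeff \<tau> \<eta> p a u $ k $ i * l $ k) = 0" if "a \<in> {1, 2, 3}" for a i
    using that by (auto simp: vec_eq_iff vector_matrix_mult_def mult.commute)
  have "(span_matrix \<xi> u *v l) $ m = 0" for m
  proof -
    have swap: "(\<Sum>k\<in>UNIV. (\<Sum>i\<in>UNIV. compat_coeff \<tau> \<eta> p a u $ k $ i * \<xi> m i $ a) * l $ k) = 0" if "a \<in> {1, 2, 3}" for a
    proof -
      have "(\<Sum>k\<in>UNIV. (\<Sum>i\<in>UNIV. compat_coeff \<tau> \<eta> p a u $ k $ i * \<xi> m i $ a) * l $ k) =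
          (\<Sum>i\<in>UNIV. \<xi> m i $ a * (\<Sum>k\<in>UNIV. compat_coeff \<tau> \<eta> p a u $ k $ i * l $ k))"
        unfolding sum_distrib_left sum_distrib_right by (subst sum.swap) (simp add: mult_ac)
      then show ?thesis
        using 0[OF that] by simp
    qed
    show ?thesis
      unfolding matrix_vector_mult_def span_matrix_def vec_lambda_beta pair_sum_compat_coeff ring_distribs sum.distrib
      using swap[of 1] swap[of 2] swap[of 3] by simp
  qed
  then have "span_matrix \<xi> u *v l = 0"
    by (simp add: vec_eq_iff)
  then have "M' *v (span_matrix \<xi> u *v l) = 0"
    by simp
  then show "l = 0"
    by (simp add: matrix_vector_mul_assoc M')
qed

text \<open>If the pair sums represent the Lagrange basis of the shifted nodes, their matrix of node
  values is the identity.\<close>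

lemma spanning_imp_generic:
  fixes u :: "complex^'n"
  assumes "spanning \<tau> \<eta> UNIV (vec_nth u) p" "incongruent_on \<tau> UNIV (vec_nth u)"
  shows "u \<in> generic_points"
proof -
  let ?v = "\<lambda>k. u $ k - \<eta> / of_nat CARD('n)"
  have "\<exists>\<xi>. \<forall>z. lagrange_theta \<tau> UNIV ?v \<eta> m z = pair_sum p (pair_theta \<tau> \<eta> UNIV (vec_nth u) z) \<xi> UNIV" for m
    using assms(1) lagrange_theta_in_Theta_space[OF tau, of UNIV m ?v \<eta>]
    unfolding spanning_def sum_shifted_coordinates by simp
  then obtain \<xi> where \<xi>: "\<And>m z. lagrange_theta \<tau> UNIV ?v \<eta> m z = pair_sum p (pair_theta \<tau> \<eta> UNIV (vec_nth u) z) (\<xi> m) UNIV"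
    by metis
  have "lagrange_theta \<tau> UNIV ?v \<eta> m (?v k) = (if m = k then 1 else 0)" for m k
    by (rule lagrange_theta_node[OF tau, where v = ?v]) (use assms(2) eta in \<open>auto simp: incongruent_on_def\<close>)
  then have "span_matrix \<xi> u = mat 1"
    by (simp add: span_matrix_def mat_def \<xi>[symmetric])
  then have "det (span_matrix \<xi> u) \<noteq> 0"
    by simp
  then show ?thesis
    unfolding generic_points_def by blast
qed

lemma generic_points_dense:
  assumes nz: "\<And>i. p i \<noteq> 0" and abc: "tri (p a) (p b) (p c) \<noteq> 0"
  shows "snd ` D \<subseteq> closure (snd ` D \<inter> generic_points)"
proof
  fix u0
  assume u0: "u0 \<in> snd ` D"
  then have inc: "incongruent_on \<tau> UNIV (vec_nth u0)"
    using incongruent_coordinates[OF tau eta D] by (auto simp: incongruent_on_def)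
  then obtain us where us: "spanning \<tau> \<eta> UNIV us p"
    using spanning_exists[OF tau eta, of "vec_nth u0" UNIV p a b c] nz abc by auto
  show "u0 \<in> closure (snd ` D \<inter> generic_points)"
    unfolding closure_approachable
  proof (intro allI impI)
    fix e :: real
    assume e: "e > 0"
    define f where "f = (\<lambda>z. \<chi> i. u0 $ i + z * (us i - u0 $ i))"
    have "open (f -` (ball u0 e \<inter> snd ` D))"
      unfolding f_def by (intro open_vimage open_Int open_snd_D[OF tau eta D] continuous_intros) auto
    moreover have "0 \<in> f -` (ball u0 e \<inter> snd ` D)"
      using u0 e by (simp add: f_def)
    ultimately obtain d where d: "d > 0" "ball 0 d \<subseteq> f -` (ball u0 e \<inter> snd ` D)"
      by (rule openE)
    obtain z where z: "norm z < d" "incongruent_on \<tau> UNIV (\<lambda>i. u0 $ i + z * (us i - u0 $ i))"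
      "spanning \<tau> \<eta> UNIV (\<lambda>i. u0 $ i + z * (us i - u0 $ i)) p"
      using spanning_perturb[OF tau eta us inc _ d(1)] by auto
    moreover have "vec_nth (f z) = (\<lambda>i. u0 $ i + z * (us i - u0 $ i))"
      by (simp add: f_def fun_eq_iff)
    ultimately have "f z \<in> generic_points"
      by (intro spanning_imp_generic) simp_all
    moreover have "f z \<in> ball u0 e \<inter> snd ` D"
      using d(2) z(1) by auto
    ultimately show "\<exists>y\<in>snd ` D \<inter> generic_points. dist y u0 < e"
      by (intro bexI[of _ "f z"]) (auto simp: dist_commute)
  qed
qed

end

theorem proposition5:
  fixes \<tau> \<eta> :: complex
    and D :: "(complex \<times> (complex^'n)) set"
    and \<phi> \<phi>1 \<phi>2 F G H :: "complex \<Rightarrow> complex^'n \<Rightarrow> complex"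
  assumes n: "CARD('n) \<ge> 3"
    and tau: "Im \<tau> > 0"
    and eta: "\<eta> \<notin> period_lattice \<tau>"
    and D: "open D" "connected D" "D \<noteq> {}" "D \<subseteq> admissible \<tau>"
    and phi: "theta_solution \<tau> \<eta> (snd ` D) \<phi>"
    and phi1: "theta_solution \<tau> \<eta> (snd ` D) \<phi>1"
    and phi2: "theta_solution \<tau> \<eta> (snd ` D) \<phi>2"
    and indep: "lin_indep3 (snd ` D) \<phi> \<phi>1 \<phi>2"
    and F: "potential_eqs \<tau> \<eta> D F \<phi>"
    and G: "potential_eqs \<tau> \<eta> D G \<phi>1"
    and H: "potential_eqs \<tau> \<eta> D H \<phi>2"
    and occur: "CARD('n) > 3 \<Longrightarrow> all_variables_occur D F G H"
  shows "\<exists>a b c :: complex^'n \<Rightarrow> complex^'n^'n.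
    (\<forall>i j. analytic_vec (\<lambda>u. a u $ i $ j) (snd ` D) \<and>
           analytic_vec (\<lambda>u. b u $ i $ j) (snd ` D) \<and>
           analytic_vec (\<lambda>u. c u $ i $ j) (snd ` D)) \<and>
    pseudopotential_for D F G H a b c \<and>
    (\<exists>V. open V \<and> V \<subseteq> snd ` D \<and> snd ` D \<subseteq> closure V \<and> independent_equations V a b c)"
proof -
  have U: "open (snd ` D)"
    by (rule open_snd_D[OF tau eta D(1,2,4)])
  \<comment> \<open>The residue coefficients are constant on the connected projection of D, so any
    base point defines the vectors p_j.\<close>
  obtain u1 where u1: "u1 \<in> snd ` D"
    using D(3) by auto
  define p :: "'n \<Rightarrow> complex^3" where
    "p = (\<lambda>j. vector [residue_coeff \<tau> \<phi> j u1, residue_coeff \<tau> \<phi>1 j u1, residue_coeff \<tau> \<phi>2 j u1])"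
  have p: "residue_coeff \<tau> \<phi> j u = p j $ 1" "residue_coeff \<tau> \<phi>1 j u = p j $ 2" "residue_coeff \<tau> \<phi>2 j u = p j $ 3"
    if "u \<in> snd ` D" for j u
    using residue_coeff_constant[OF tau eta D(1,2,4) phi F that u1]
      residue_coeff_constant[OF tau eta D(1,2,4) phi1 G that u1]
      residue_coeff_constant[OF tau eta D(1,2,4) phi2 H that u1] by (simp_all add: p_def)
  have "\<exists>a b c. tri (p a) (p b) (p c) \<noteq> 0"
  proof (rule ccontr)
    assume "\<not> ?thesis"
    then have zero: "tri (p a) (p b) (p c) = 0" for a b c
      by blast
    obtain k :: "complex^3" where k: "k \<noteq> 0" and rel: "\<And>j. k $ 1 * p j $ 1 + k $ 2 * p j $ 2 + k $ 3 * p j $ 3 = 0"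
      by (rule linear_relation_if_tri_zero[of p, OF zero]) (rule that)
    have "k $ 1 * \<phi> \<zeta> u + k $ 2 * \<phi>1 \<zeta> u + k $ 3 * \<phi>2 \<zeta> u = 0" if u: "u \<in> snd ` D" for \<zeta> u
    proof -
      note expansion = theta_solution_expansion[OF tau eta D(1,2,4) _ u]
      have "k $ 1 * \<phi> \<zeta> u + k $ 2 * \<phi>1 \<zeta> u + k $ 3 * \<phi>2 \<zeta> u =
          (\<Sum>j\<in>UNIV. (k $ 1 * p j $ 1 + k $ 2 * p j $ 2 + k $ 3 * p j $ 3) * theta_basis \<tau> \<eta> j \<zeta> u)"
        unfolding expansion[OF phi] expansion[OF phi1] expansion[OF phi2] p[OF u]
          sum_distrib_left sum.distrib[symmetric]
        by (intro sum.cong refl) (simp only: ring_distribs mult.assoc)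
      then show ?thesis
        unfolding rel by simp
    qed
    then have "k $ 1 = 0 \<and> k $ 2 = 0 \<and> k $ 3 = 0"
      using indep unfolding lin_indep3_def by blast
    then show False
      using k by (simp add: vec_eq_iff forall_3)
  qed
  then obtain a b c where abc: "tri (p a) (p b) (p c) \<noteq> 0"
    by blast
  \<comment> \<open>For n > 3, a vanishing p_i would make the u_i-derivatives of F, G and H all zero
    on D. For n = 3 the triple a, b, c exhausts the indices, and a nonzero determinant has no zero
    row.\<close>
  have nz: "p i \<noteq> 0" for i
  proof (cases "CARD('n) > 3")
    case True
    then obtain \<zeta> u where zu: "(\<zeta>, u) \<in> D" "pd (F \<zeta>) i u \<noteq> 0 \<or> pd (G \<zeta>) i u \<noteq> 0 \<or> pd (H \<zeta>) i u \<noteq> 0"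
      using occur unfolding all_variables_occur_def by blast
    then have u: "u \<in> snd ` D"
      by force
    note R = potential_eqs_residue(2)[OF tau eta D(1,2,4)]
    show ?thesis
      using zu(2) unfolding R[OF phi F zu(1)] R[OF phi1 G zu(1)] R[OF phi2 H zu(1)] p[OF u] by auto
  next
    case False
    have "card {a, b, c} = 3"
      using abc by (auto simp: card_insert_if)
    then have "{a, b, c} = UNIV"
      using False n by (intro card_subset_eq) auto
    then have "i \<in> {a, b, c}"
      by blast
    then show ?thesis
      using tri_nonzero_imp_nonzero[OF abc] by blast
  qed
  let ?A = "compat_coeff \<tau> \<eta> p"
  have "analytic_vec (\<lambda>u. ?A l u $ i $ j) (snd ` D)" for l i j
    by (rule analytic_compat_coeff[OF tau eta D(1,2,4)])
  moreover have "pseudopotential_for D F G H (?A 1) (?A 2) (?A 3)"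
    unfolding pseudopotential_for_def
    using compatible_iff_quasilinear[OF tau eta D(1,2,4) phi F phi1 G phi2 H p] by blast
  moreover have "\<exists>V. open V \<and> V \<subseteq> snd ` D \<and> snd ` D \<subseteq> closure V \<and> independent_equations V (?A 1) (?A 2) (?A 3)"
    using open_Int[OF U open_generic_points[OF tau eta D(1,2,4)]]
      generic_points_dense[OF tau eta D(1,2,4) nz abc]
      independent_generic_points[OF tau eta D(1,2,4), OF Int_lower2]
    by (intro exI[of _ "snd ` D \<inter> generic_points \<tau> \<eta> p"]) simp
  ultimately show ?thesis
    by blast
qed

end
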